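(* Let $\lambda>0$, $-\infty<\mu<\infty$ and $\alpha=-\frac12-i\mu$. Then for $0<x<\infty$, $$\frac1\pi\int_0^\infty\frac{t^{\alpha/2}J_\alpha(\lambda\sqrt t)\,dt}{t-x}+i\tanh(\pi\mu)\,x^{\alpha/2}J_\alpha(\lambda\sqrt x)=-\frac{x^{\alpha/2}}{\cosh\pi\mu}\,J_{-\alpha}(\lambda\sqrt x).$$
   Context: $J_\alpha$ is the Bessel function of the first kind (of complex order $\alpha$). Powers of positive numbers are principal, and the integral is a Cauchy principal value at $t=x$. *)

theory Defs
  imports "HOL-Analysis.Analysis"
begin

text \<open>
  The factor \<open>(z/2)\<^sup>a\<close> is principal (cut along the negative real axis). The entire function
  \<^const>\<open>rGamma\<close> (the reciprocal of Gamma) makes the series meaningful also when \<open>a\<close> is a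
  negative integer. As \<open>0 powr a = 0\<close> for every \<open>a\<close>, the value at \<open>z = 0\<close> is a dummy.
\<close>

definition bessel_J :: "complex \<Rightarrow> complex \<Rightarrow> complex" where
  "bessel_J a z = (z / 2) powr a *
     (\<Sum>k. (-1) ^ k * rGamma (of_nat k + a + 1) / fact k * (z / 2) ^ (2 * k))"

text \<open>
  Cauchy principal value at \<open>c\<close> of the integral of \<open>f\<close> over \<open>S\<close>. The truncated integrals are
  required to exist, because the Bochner integral of a non-integrable function is 0.
\<close>

definition has_pv_integral :: "(real \<Rightarrow> complex) \<Rightarrow> real set \<Rightarrow> real \<Rightarrow> complex \<Rightarrow> bool" where
  "has_pv_integral f S c I \<longleftrightarrow>
     (\<forall>e>0. set_integrable lborel (S - {c-e..c+e}) f) \<and>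
     ((\<lambda>e. LINT t:(S - {c-e..c+e})|lborel. f t) \<longlongrightarrow> I) (at_right 0)"

definition pv_integrable :: "(real \<Rightarrow> complex) \<Rightarrow> real set \<Rightarrow> real \<Rightarrow> bool" where
  "pv_integrable f S c \<longleftrightarrow> (\<exists>I. has_pv_integral f S c I)"

definition pv_integral :: "(real \<Rightarrow> complex) \<Rightarrow> real set \<Rightarrow> real \<Rightarrow> complex" where
  "pv_integral f S c = (THE I. has_pv_integral f S c I)"

lemma pv_integral_eqI:
  assumes "has_pv_integral f S c I"
  shows "pv_integral f S c = I"
  unfolding pv_integral_def
proof (rule the_equality[of "has_pv_integral f S c", OF assms])
  fix J assume "has_pv_integral f S c J"
  then show "J = I"
    using assms unfolding has_pv_integral_def
    by (meson tendsto_unique trivial_limit_at_right_real)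
qed

end

theory Submission
  imports Defs "HOL-Complex_Analysis.Complex_Analysis" "HOL-Real_Asymp.Real_Asymp"
begin

text \<open>
  Put \<open>b = (\<lambda>/2)\<^sup>2\<close> and write \<open>J\<close> through the entire Bessel-Clifford function \<open>C\<close>, so that up to a
  constant the numerator of the integrand is \<open>h(t) = t\<^sup>\<alpha> C\<^sub>\<alpha>(- b t)\<close>, which is \<open>O(t\<^sup>-\<^sup>1\<^sup>/\<^sup>2)\<close>. The
  Laplace transform of \<open>h\<close> at \<open>p\<close> is \<open>p\<^sup>-\<^sup>\<alpha>\<^sup>-\<^sup>1 exp(- b/p)\<close>, and integrating it once more shows that the
  Stieltjes transform \<open>S(w) = \<integral> h(t)/(t + w) dt\<close> equals \<open>w\<^sup>\<alpha> K\<^sub>\<alpha>(b w)\<close> for \<open>w > 0\<close>, where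
  \<open>K\<^sub>\<alpha>(c) = \<integral> q\<^sup>-\<^sup>\<alpha>\<^sup>-\<^sup>1 exp(- q - c/q) dq\<close>. A Wronskian argument expresses \<open>K\<^sub>\<alpha>\<close> by \<open>C\<^sub>\<alpha>\<close> and
  \<open>C\<^sub>-\<^sub>\<alpha>\<close>; the resulting formula for \<open>S\<close> extends to the plane slit along the negative axis, and the
  principal value is the mean of the two boundary values of \<open>S\<close> at \<open>- x\<close>.
\<close>

section \<open>The Bessel-Clifford function\<close>

text \<open>On the line \<open>Re \<alpha> = - 1 / 2\<close> the bound for \<open>h\<close> holds on
  the whole half-line, so dividing by \<open>1 + t\<close> leaves an integrable function and the
  point \<open>t = x\<close> is the only one that needs a principal value. The Laplace route gives
  \<open>S\<close> only for \<open>w > 0\<close>, and the integral \<open>K\<close> only makes sense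
  for \<open>Re c > 0\<close>; neither reaches the cut, hence the continuation. In the continued
  formula only the term with \<open>z powr \<alpha>\<close> jumps across the cut: in the other one
  \<open>z powr \<alpha> * z powr (- \<alpha>) = 1\<close> removes the branch. The mean of
  \<open>exp (i pi \<alpha>)\<close> and \<open>exp (- i pi \<alpha>)\<close> is
  \<open>cos (pi \<alpha>) = - i sinh (pi \<mu>)\<close>, and the constant
  \<open>rGamma (\<alpha> + 1) * rGamma (- \<alpha>)\<close> that multiplies \<open>S\<close> is
  \<open>cosh (pi \<mu>) / pi\<close> by reflection. Their quotient is the source of
  \<open>tanh\<close>, of \<open>1 / cosh\<close> and of the factor \<open>1 / pi\<close>.\<close>

definition bessel_clifford :: "complex \<Rightarrow> complex \<Rightarrow> complex" where
  "bessel_clifford a z = (\<Sum>k. rGamma (of_nat k + a + 1) / fact k * z ^ k)"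

text \<open>Serves twice: it shows that \<open>diffs\<close> raises the order \<open>a\<close> by
  one, and it matches the shifted series in the recurrence below.\<close>

lemma bessel_clifford_coeff_Suc:
  "of_nat (Suc k) * (rGamma (of_nat (Suc k) + a + 1) / fact (Suc k))
     = rGamma (of_nat k + (a + 1) + 1) / (fact k :: complex)"
proof -
  have "of_nat (Suc k) + a + 1 = of_nat k + (a + 1) + (1::complex)"
    by simp
  from arg_cong[OF this, of rGamma] show ?thesis
    unfolding fact_Suc using of_nat_neq_0[of k, where ?'a = complex]
    by (simp del: of_nat_Suc)
qed

lemma summable_norm_bessel_clifford:
  "summable (\<lambda>k. norm (rGamma (of_nat k + a + 1) / fact k * z ^ k :: complex))"
proof -
  \<comment> \<open>From \<open>N\<close> on, \<open>norm (of_nat n + a + 1)\<close> is at least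
    \<open>1\<close> and at least \<open>2 * norm z\<close>: the first gives a nonzero divisor, the
    second a ratio of at most \<open>1/2\<close>.\<close>
  obtain N :: nat where N: "real N \<ge> norm a + 2 * norm z + 1"
    using real_arch_simple by blast
  show ?thesis
  proof (rule summable_ratio_test[where c = "1/2" and N = N])
    fix n assume n: "n \<ge> N"
    let ?s = "of_nat n + a + 1 :: complex"
    have "norm (of_nat n + 1 :: complex) \<le> norm ?s + norm a"
      using norm_triangle_ineq4[of ?s a] by (simp add: algebra_simps)
    moreover have "norm (of_nat n + 1 :: complex) = real n + 1"
      by (metis norm_of_nat of_nat_Suc add.commute)
    ultimately have s: "norm ?s \<ge> 1" "norm ?s \<ge> 2 * norm z"
      using N of_nat_mono[OF n, where ?'a = real] norm_ge_zero[of z] norm_ge_zero[of a]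
      by linarith+
    then have s0: "?s \<noteq> 0" by auto
    have r: "rGamma (of_nat (Suc n) + a + 1) = rGamma ?s / ?s"
      using rGamma_plus1[of ?s] s0 by (simp add: field_simps add.assoc)
    have "norm z / (norm ?s * (real n + 1)) \<le> norm z / norm ?s"
      using s s0 by (intro divide_left_mono mult_pos_pos) (auto simp: mult_le_cancel_left1)
    also have "\<dots> \<le> 1/2"
      using s by (simp add: divide_simps)
    finally have le: "norm z / (norm ?s * (real n + 1)) \<le> 1/2" .
    have "norm (rGamma (of_nat (Suc n) + a + 1) / fact (Suc n) * z ^ Suc n)
        = norm z / (norm ?s * (real n + 1)) * norm (rGamma ?s / fact n * z ^ n)"
      unfolding r fact_Suc norm_mult norm_divide norm_power power_Suc norm_of_nat
      using s0 by (simp add: field_simps)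
    also have "\<dots> \<le> 1/2 * norm (rGamma ?s / fact n * z ^ n)"
      by (intro mult_right_mono le) auto
    finally show "norm (norm (rGamma (of_nat (Suc n) + a + 1) / fact (Suc n) * z ^ Suc n))
        \<le> 1/2 * norm (norm (rGamma ?s / fact n * z ^ n))"
      by (simp only: real_norm_def abs_norm_cancel)
  qed simp
qed

lemmas summable_bessel_clifford = summable_norm_bessel_clifford [THEN summable_norm_cancel]

lemma has_field_derivative_bessel_clifford:
  "(bessel_clifford a has_field_derivative bessel_clifford (a + 1) z) (at z)"
proof -
  let ?c = "\<lambda>k. rGamma (of_nat k + a + 1) / fact k :: complex"
  have "((\<lambda>z. \<Sum>k. ?c k * z ^ k) has_field_derivative (\<Sum>k. diffs ?c k * z ^ k)) (at z)"
    by (rule termdiffs_strong_converges_everywhere) (rule summable_bessel_clifford)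
  also have "diffs ?c = (\<lambda>k. rGamma (of_nat k + (a + 1) + 1) / fact k)"
    unfolding diffs_def using bessel_clifford_coeff_Suc by presburger
  finally show ?thesis
    unfolding bessel_clifford_def [abs_def] .
qed

lemmas has_field_derivative_bessel_clifford' [derivative_intros] =
  DERIV_chain2[OF has_field_derivative_bessel_clifford]

lemma continuous_on_bessel_clifford [continuous_intros]:
  "continuous_on A f \<Longrightarrow> continuous_on A (\<lambda>x. bessel_clifford a (f x))"
  by (rule continuous_on_compose2[of UNIV "bessel_clifford a"])
     (auto intro!: DERIV_continuous_on has_field_derivative_bessel_clifford
           intro: has_field_derivative_at_within)

lemma holomorphic_on_bessel_clifford [holomorphic_intros]:
  assumes "f holomorphic_on A"
  shows "(\<lambda>z. bessel_clifford a (f z)) holomorphic_on A"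
proof -
  have "bessel_clifford a holomorphic_on UNIV"
    unfolding holomorphic_on_open[OF open_UNIV]
    using has_field_derivative_bessel_clifford by blast
  from holomorphic_on_compose_gen[OF assms this] show ?thesis
    by (simp add: o_def)
qed

lemma isCont_bessel_clifford: "isCont (bessel_clifford a) z"
  using has_field_derivative_bessel_clifford by (rule DERIV_isCont)

lemma bessel_clifford_0 [simp]: "bessel_clifford a 0 = rGamma (a + 1)"
proof -
  have "bessel_clifford a 0 = (\<Sum>k. (rGamma (of_nat k + a + 1) / fact k) * 0 ^ k)"
    by (simp add: bessel_clifford_def)
  also have "\<dots> = rGamma (a + 1)"
    by (subst powser_zero) simp
  finally show ?thesis .
qed

text \<open>Coefficientwise this is \<open>rGamma s = s * rGamma (s + 1)\<close> with
  \<open>s = k + a + 1\<close> split into \<open>k\<close> and \<open>a + 1\<close>. As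
  differentiation raises the order by one, it is the differential equation
  \<open>z y'' + (a + 1) y' = y\<close>.\<close>

lemma bessel_clifford_recurrence:
  "z * bessel_clifford (a + 2) z + (a + 1) * bessel_clifford (a + 1) z = bessel_clifford a z"
proof -
  let ?g = "\<lambda>a k. rGamma (of_nat k + a + 1) / fact k * z ^ k"
  have 1: "(\<lambda>k. ?g (a + 1) k) sums bessel_clifford (a + 1) z"
    and 2: "(\<lambda>k. ?g (a + 2) k) sums bessel_clifford (a + 2) z"
    unfolding bessel_clifford_def by (intro summable_sums summable_bessel_clifford)+
  \<comment> \<open>The series of \<open>z * bessel_clifford (a + 2) z\<close> moved by one place,
    with a zero in front; its \<open>k\<close>-th entry turns out to be \<open>k\<close> times the
    term of order \<open>a + 1\<close>.\<close>
  define d where "d = (\<lambda>k. case k of 0 \<Rightarrow> 0 | Suc j \<Rightarrow> z * ?g (a + 2) j)"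
  have "(\<lambda>j. d (Suc j)) sums (z * bessel_clifford (a + 2) z)"
    unfolding d_def using sums_mult[OF 2, of z] by simp
  then have "d sums (z * bessel_clifford (a + 2) z)"
    unfolding sums_Suc_iff by (simp add: d_def)
  then have "(\<lambda>k. d k + (a + 1) * ?g (a + 1) k) sums
      (z * bessel_clifford (a + 2) z + (a + 1) * bessel_clifford (a + 1) z)"
    by (intro sums_add sums_mult 1)
  also have "(\<lambda>k. d k + (a + 1) * ?g (a + 1) k) = ?g a"
  proof
    fix k
    have "rGamma (of_nat k + a + 1) = (of_nat k + a + 1) * rGamma (of_nat k + (a + 1) + 1)"
      using rGamma_plus1[of "of_nat k + a + 1"] by (simp add: add.assoc)
    moreover have "d k = of_nat k * ?g (a + 1) k"
    proof (cases k)
      case (Suc j)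
      have "of_nat k * ?g (a + 1) k
          = of_nat (Suc j) * (rGamma (of_nat (Suc j) + (a + 1) + 1) / fact (Suc j)) * (z * z ^ j)"
        unfolding Suc by (simp del: of_nat_Suc fact_Suc)
      then show ?thesis
        unfolding bessel_clifford_coeff_Suc Suc d_def by (simp add: add.assoc)
    qed (simp add: d_def)
    ultimately show "d k + (a + 1) * ?g (a + 1) k = ?g a k"
      by (simp add: field_simps)
  qed
  finally show ?thesis
    unfolding bessel_clifford_def by (simp add: sums_iff)
qed

lemma bessel_J_conv_bessel_clifford:
  "bessel_J a z = (z / 2) powr a * bessel_clifford a (- ((z / 2)\<^sup>2))"
proof -
  have eq: "(- ((z / 2)\<^sup>2)) ^ k = (- 1) ^ k * (z / 2) ^ (2 * k)" for k
    unfolding power_mult by (rule power_minus)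
  have "(- 1) ^ k * rGamma (of_nat k + a + 1) / fact k * (z / 2) ^ (2 * k)
      = rGamma (of_nat k + a + 1) / fact k * (- ((z / 2)\<^sup>2)) ^ k" for k
    unfolding eq by (simp add: mult_ac)
  then show ?thesis
    unfolding bessel_J_def bessel_clifford_def by presburger
qed

text \<open>
  For \<open>Re a = - 1/2\<close> the energy \<open>|y|\<^sup>2 + c |y'|\<^sup>2\<close> of \<open>y(c) = bessel_clifford a (- c)\<close> is
  conserved.
\<close>

lemma norm_bessel_clifford_neg_le:
  assumes a: "Re a = - 1 / 2" and c: "c \<ge> 0"
  shows "norm (bessel_clifford a (- of_real c)) \<le> norm (rGamma (a + 1))"
proof -
  define y where "y = (\<lambda>c::real. bessel_clifford a (- of_real c))"
  define v where "v = (\<lambda>c::real. bessel_clifford (a + 1) (- of_real c))"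
  define u where "u = (\<lambda>c::real. bessel_clifford (a + 2) (- of_real c))"
  define E where "E = (\<lambda>c. y c \<bullet> y c + c * (v c \<bullet> v c))"
  have y': "(y has_vector_derivative - v c) (at c)" for c
  proof -
    have "((\<lambda>c. bessel_clifford a (- c)) has_field_derivative - v c) (at (of_real c))"
      unfolding v_def by (auto intro!: derivative_eq_intros)
    from has_vector_derivative_real_field[OF this] show ?thesis by (simp add: y_def)
  qed
  have v': "(v has_vector_derivative - u c) (at c)" for c
  proof -
    have "((\<lambda>c. bessel_clifford (a + 1) (- c)) has_field_derivative - u c) (at (of_real c))"
      unfolding u_def by (auto intro!: derivative_eq_intros simp: add.assoc)
    from has_vector_derivative_real_field[OF this] show ?thesis by (simp add: v_def)
  qed
  have ode: "of_real c * u c = (a + 1) * v c - y c" for c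
    using bessel_clifford_recurrence[of "- of_real c" a]
    by (simp add: y_def v_def u_def algebra_simps)
  have "(E has_real_derivative 0) (at c)" for c
  proof -
    have iv: "((\<lambda>c. f c \<bullet> f c) has_real_derivative 2 * (f c \<bullet> f')) (at c)"
      if "(f has_vector_derivative f') (at c)" for f :: "real \<Rightarrow> complex" and f' c
    proof -
      have "((\<lambda>c. f c \<bullet> f c) has_vector_derivative (f c \<bullet> f' + f' \<bullet> f c)) (at c)"
        using that that by (rule bounded_bilinear.has_vector_derivative[OF bounded_bilinear_inner])
      then show ?thesis
        by (simp add: has_real_derivative_iff_has_vector_derivative inner_commute)
    qed
    have "(E has_real_derivative
        2 * (y c \<bullet> - v c) + (1 * (v c \<bullet> v c) + 2 * (v c \<bullet> - u c) * c)) (at c)"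
      unfolding E_def by (intro DERIV_add DERIV_mult iv y' v' DERIV_ident)
    also have "2 * (y c \<bullet> - v c) + (1 * (v c \<bullet> v c) + 2 * (v c \<bullet> - u c) * c)
        = v c \<bullet> v c - 2 * (y c \<bullet> v c) - 2 * (v c \<bullet> (of_real c * u c))"
      by (simp add: inner_complex_def algebra_simps)
    \<comment> \<open>Here \<open>Re a = - 1 / 2\<close> enters: inserting the differential equation
      leaves \<open>(1 - 2 * Re (a + 1)) * |v|^2\<close>, whose coefficient vanishes.\<close>
    also have "\<dots> = 0"
      unfolding ode using a by (simp add: inner_complex_def algebra_simps)
    finally show ?thesis .
  qed
  then have "E c = E 0"
    using DERIV_isconst_all by blast
  then have "(norm (y c))\<^sup>2 \<le> (norm (y 0))\<^sup>2"
    using c unfolding E_def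
    by (metis add.right_neutral dot_square_norm inner_ge_zero le_add_same_cancel1 mult_nonneg_nonneg mult_zero_left)
  then show ?thesis
    by (simp add: y_def power2_le_iff_abs_le)
qed

section \<open>Integration over the positive half-line\<close>

text \<open>First countability reduces the claim to sequences. Measurability and the bound hold only
  eventually, so an initial segment of each sequence is cut off before dominated convergence is
  applied.\<close>

lemma tendsto_integral_dominated:
  fixes s :: "'b::first_countable_topology \<Rightarrow> 'a \<Rightarrow> 'c::{banach, second_countable_topology}"
  assumes "\<forall>\<^sub>F y in at y0 within Y. s y \<in> borel_measurable M"
    and "f \<in> borel_measurable M" and "integrable M w"
    and "\<forall>\<^sub>F y in at y0 within Y. \<forall>t\<in>space M. norm (s y t) \<le> w t"
    and "\<And>t. t \<in> space M \<Longrightarrow> ((\<lambda>y. s y t) \<longlongrightarrow> f t) (at y0 within Y)"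
  shows "((\<lambda>y. LINT t|M. s y t) \<longlongrightarrow> (LINT t|M. f t)) (at y0 within Y)"
  unfolding tendsto_at_iff_sequentially
proof (intro allI impI)
  fix X :: "nat \<Rightarrow> 'b"
  assume X: "\<forall>i. X i \<in> Y - {y0}" "X \<longlonglongrightarrow> y0"
  then have lim: "filterlim X (at y0 within Y) sequentially"
    unfolding filterlim_at by (auto intro: always_eventually)
  from assms(1,4) have "\<forall>\<^sub>F y in at y0 within Y.
      s y \<in> borel_measurable M \<and> (\<forall>t\<in>space M. norm (s y t) \<le> w t)"
    by eventually_elim auto
  from eventually_compose_filterlim[OF this lim] obtain N where
    N: "\<And>n. n \<ge> N \<Longrightarrow> s (X n) \<in> borel_measurable M"
       "\<And>n t. n \<ge> N \<Longrightarrow> t \<in> space M \<Longrightarrow> norm (s (X n) t) \<le> w t"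
    unfolding eventually_sequentially by blast
  have "(\<lambda>n. LINT t|M. s (X (n + N)) t) \<longlonglongrightarrow> (LINT t|M. f t)"
  proof (rule integral_dominated_convergence[where w = w])
    have "(\<lambda>n. s (X (n + N)) t) \<longlonglongrightarrow> f t" if "t \<in> space M" for t
      by (rule LIMSEQ_ignore_initial_segment) (rule filterlim_compose[OF assms(5)[OF that] lim])
    then show "AE t in M. (\<lambda>n. s (X (n + N)) t) \<longlonglongrightarrow> f t"
      by (intro AE_I2)
  qed (use assms N in auto)
  then show "((\<lambda>y. LINT t|M. s y t) \<circ> X) \<longlonglongrightarrow> (LINT t|M. f t)"
    unfolding o_def by (rule LIMSEQ_offset)
qed

text \<open>By the mean value inequality on the ball, \<open>w\<close> bounds the difference
  quotients as well as the derivatives, so dominated convergence applies to them.\<close>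

lemma has_field_derivative_integral_dominated:
  fixes F F' :: "complex \<Rightarrow> 'a \<Rightarrow> complex"
  assumes "r > 0"
    and F: "\<And>z t. z \<in> ball z0 r \<Longrightarrow> t \<in> space M \<Longrightarrow>
              ((\<lambda>z. F z t) has_field_derivative F' z t) (at z)"
    and le: "\<And>z t. z \<in> ball z0 r \<Longrightarrow> t \<in> space M \<Longrightarrow> norm (F' z t) \<le> w t"
    and w: "integrable M w"
    and int: "\<And>z. z \<in> ball z0 r \<Longrightarrow> integrable M (F z)"
    and meas: "F' z0 \<in> borel_measurable M"
  shows "((\<lambda>z. LINT t|M. F z t) has_field_derivative (LINT t|M. F' z0 t)) (at z0)"
proof -
  have ev: "\<forall>\<^sub>F z in at z0. z \<in> ball z0 r - {z0}"
    using \<open>r > 0\<close> by (intro eventually_at_in_open) auto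
  have z0: "z0 \<in> ball z0 r" using \<open>r > 0\<close> by simp
  have "((\<lambda>z. LINT t|M. (F z t - F z0 t) / (z - z0)) \<longlongrightarrow> (LINT t|M. F' z0 t)) (at z0)"
  proof (rule tendsto_integral_dominated[OF _ meas w])
    show "\<forall>\<^sub>F z in at z0. (\<lambda>t. (F z t - F z0 t) / (z - z0)) \<in> borel_measurable M"
      using ev
    proof eventually_elim
      case (elim z)
      then have "integrable M (\<lambda>t. (F z t - F z0 t) / (z - z0))"
        using int z0 by (intro integrable_divide Bochner_Integration.integrable_diff) auto
      then show ?case by (rule borel_measurable_integrable)
    qed
    show "\<forall>\<^sub>F z in at z0. \<forall>t\<in>space M. norm ((F z t - F z0 t) / (z - z0)) \<le> w t"
      using ev
    proof eventually_elim
      case (elim z)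
      show ?case
      proof
        fix t assume t: "t \<in> space M"
        have "norm (F z t - F z0 t) \<le> w t * norm (z - z0)"
          by (rule field_differentiable_bound[OF convex_ball[of z0 r], of "\<lambda>z. F z t" "\<lambda>z. F' z t"])
             (use F le t z0 elim in \<open>auto intro: has_field_derivative_at_within\<close>)
        with elim show "norm ((F z t - F z0 t) / (z - z0)) \<le> w t"
          by (simp add: norm_divide divide_le_eq)
      qed
    qed
    show "((\<lambda>z. (F z t - F z0 t) / (z - z0)) \<longlongrightarrow> F' z0 t) (at z0)" if "t \<in> space M" for t
      using F[OF z0 that] unfolding has_field_derivative_iff .
  qed
  also have "?this \<longleftrightarrow>
      ((\<lambda>z. ((LINT t|M. F z t) - (LINT t|M. F z0 t)) / (z - z0)) \<longlongrightarrow> (LINT t|M. F' z0 t)) (at z0)"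
    by (intro filterlim_cong refl eventually_mono[OF ev]) (use int z0 in auto)
  finally show ?thesis unfolding has_field_derivative_iff .
qed

text \<open>With a restricted space instead of an indicator factor, pointwise hypotheses of the form
  \<open>t \<in> space M\<close> become \<open>t > 0\<close>, where powers of \<open>t\<close> are
  smooth.\<close>

abbreviation lborel_pos :: "real measure" where
  "lborel_pos \<equiv> restrict_space lborel {0<..}"

lemma space_lborel_pos [simp]: "space lborel_pos = {0<..}"
  by (simp add: space_restrict_space)

lemma borel_measurable_lborel_pos:
  "continuous_on {0<..} f \<Longrightarrow> f \<in> borel_measurable lborel_pos"
  using borel_measurable_continuous_on_restrict[of "{0<..}" f]
  by (simp cong: measurable_cong_sets sets_restrict_space_cong)

text \<open>The bridge to the change of variables theorem, which speaks of
  \<open>absolutely_integrable_on\<close>. That notion uses the completed measure; continuity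
  supplies the Borel measurability needed to come back.\<close>

lemma has_bochner_integral_lborel_pos_iff:
  fixes f :: "real \<Rightarrow> complex"
  assumes cont: "continuous_on {0<..} f"
  shows "has_bochner_integral lborel_pos f x \<longleftrightarrow>
           f absolutely_integrable_on {0<..} \<and> integral {0<..} f = x"
proof -
  have "integrable lborel_pos f \<longleftrightarrow> set_integrable lborel {0<..} f"
    by (simp add: integrable_restrict_space set_integrable_def)
  also have "\<dots> \<longleftrightarrow> f absolutely_integrable_on {0<..}"
    unfolding set_integrable_def
    by (rule integrable_completion [symmetric])
       (use borel_measurable_continuous_on_indicator[OF _ cont] in auto)
  finally have iff: "integrable lborel_pos f \<longleftrightarrow> f absolutely_integrable_on {0<..}" .
  moreover have "integral\<^sup>L lborel_pos f = integral {0<..} f" if "integrable lborel_pos f"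
  proof -
    have "set_integrable lborel {0<..} f"
      using that by (simp add: integrable_restrict_space set_integrable_def)
    from set_borel_integral_eq_integral(2)[OF this] show ?thesis
      by (simp add: integral_restrict_space set_lebesgue_integral_def)
  qed
  ultimately show ?thesis
    by (auto simp: has_bochner_integral_iff)
qed

lemma has_bochner_integral_lborel_pos_substitute:
  fixes f :: "real \<Rightarrow> complex" and g h :: "real \<Rightarrow> real"
  assumes "has_bochner_integral lborel_pos f x"
    and "continuous_on {0<..} f" "continuous_on {0<..} h"
    and "\<And>t. t > 0 \<Longrightarrow> (g has_real_derivative h t) (at t)"
    and "bij_betw g {0<..} {0<..}"
  shows "has_bochner_integral lborel_pos (\<lambda>t. \<bar>h t\<bar> *\<^sub>R f (g t)) x"
proof -
  have "continuous_on {0<..} g"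
    using assms(4) by (intro DERIV_continuous_on) (auto intro: has_field_derivative_at_within)
  then have "continuous_on {0<..} (\<lambda>t. f (g t))"
    by (rule continuous_on_compose2[OF assms(2)]) (use assms(5) in \<open>auto simp: bij_betw_def\<close>)
  then have "continuous_on {0<..} (\<lambda>t. \<bar>h t\<bar> *\<^sub>R f (g t))"
    by (intro continuous_intros assms)
  moreover have "(\<lambda>t. \<bar>h t\<bar> *\<^sub>R f (g t)) absolutely_integrable_on {0<..} \<and>
      integral {0<..} (\<lambda>t. \<bar>h t\<bar> *\<^sub>R f (g t)) = x
    \<longleftrightarrow> f absolutely_integrable_on g ` {0<..} \<and> integral (g ` {0<..}) f = x"
    by (rule has_absolute_integral_change_of_variables_real)
       (use assms in \<open>auto intro: has_field_derivative_at_within simp: bij_betw_def\<close>)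
  ultimately show ?thesis
    using assms(1,2,5) by (simp add: has_bochner_integral_lborel_pos_iff bij_betw_def)
qed

lemma has_bochner_integral_lborel_pos_scale:
  fixes f :: "real \<Rightarrow> complex"
  assumes "has_bochner_integral lborel_pos f x" "continuous_on {0<..} f" "c > 0"
  shows "has_bochner_integral lborel_pos (\<lambda>t. of_real c * f (c * t)) x"
proof -
  have "bij_betw ((*) c) {0<..} {0<..}"
    by (rule bij_betw_byWitness[where f' = "\<lambda>t. t / c"]) (use assms(3) in auto)
  moreover have "((*) c has_real_derivative c) (at t)" for t
    by (auto intro!: derivative_eq_intros)
  ultimately have "has_bochner_integral lborel_pos (\<lambda>t. \<bar>c\<bar> *\<^sub>R f (c * t)) x"
    by (intro has_bochner_integral_lborel_pos_substitute assms) auto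
  then show ?thesis
    using assms(3) by (simp add: scaleR_conv_of_real)
qed

section \<open>Gamma integrals and the Laplace transform\<close>

lemma has_bochner_integral_Gamma:
  assumes s: "Re s > 0" and p: "p > 0"
  shows "has_bochner_integral lborel_pos
           (\<lambda>t. of_real t powr (s - 1) * of_real (exp (- (p * t)))) (Gamma s * of_real p powr (- s))"
proof -
  let ?f = "\<lambda>t. of_real t powr (s - 1) * of_real (exp (- t)) :: complex"
  have f: "?f = (\<lambda>t. of_real t powr (s - 1) / of_real (exp t))"
    by (simp add: exp_minus field_simps)
  have cont: "continuous_on {0<..} ?f"
    by (intro continuous_intros) (auto simp: complex_nonpos_Reals_iff)
  have "has_bochner_integral lborel_pos ?f (Gamma s)"
    using absolutely_integrable_Gamma_integral'[OF s] Gamma_integral_complex'[OF s] cont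
    unfolding f by (simp add: has_bochner_integral_lborel_pos_iff integral_unique)
  from has_bochner_integral_lborel_pos_scale[OF this cont p]
  have "has_bochner_integral lborel_pos (\<lambda>t. of_real p powr (- s) * (of_real p * ?f (p * t)))
      (of_real p powr (- s) * Gamma s)"
    by (rule has_bochner_integral_mult_right)
  also have "?this \<longleftrightarrow> ?thesis"
  proof (rule has_bochner_integral_cong)
    fix t assume "t \<in> space lborel_pos"
    then show "of_real p powr (- s) * (of_real p * ?f (p * t))
        = of_real t powr (s - 1) * of_real (exp (- (p * t)))"
      using p by (simp add: powr_times_real powr_diff powr_minus field_simps)
  qed simp_all
  finally show ?thesis .
qed

lemma has_bochner_integral_Gamma_real:
  assumes s: "s > 0" and p: "p > 0"
  shows "has_bochner_integral lborel_pos
           (\<lambda>t. t powr (s - 1) * exp (- (p * t))) (Gamma s * p powr (- s))"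
proof -
  have eq: "of_real t powr (of_real s - 1) * of_real (exp (- (p * t)))
      = (of_real (t powr (s - 1) * exp (- (p * t))) :: complex)" if "t > 0" for t
    using that powr_of_real[of t "s - 1"] by simp
  have val: "Gamma (of_real s) * of_real p powr (- of_real s)
      = (of_real (Gamma s * p powr (- s)) :: complex)"
    using p powr_of_real[of p "- s"] by (simp add: Gamma_complex_of_real)
  have "has_bochner_integral lborel_pos
           (\<lambda>t. of_real t powr (of_real s - 1) * of_real (exp (- (p * t))))
           (Gamma (of_real s) * of_real p powr (- of_real s) :: complex)"
    by (rule has_bochner_integral_Gamma) (use s p in auto)
  also have "?this \<longleftrightarrow> has_bochner_integral lborel_pos
           (\<lambda>t. of_real (t powr (s - 1) * exp (- (p * t))))
           (of_real (Gamma s * p powr (- s)) :: complex)"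
    unfolding val by (rule has_bochner_integral_cong) (simp_all only: space_lborel_pos greaterThan_iff eq)
  finally show ?thesis
    by (auto dest!: has_bochner_integral_bounded_linear[OF bounded_linear_Re]
          simp only: Re_complex_of_real)
qed

text \<open>Passing from \<open>k\<close> to \<open>k + 1\<close> multiplies the left side by
  \<open>(k + Re a + 1) / norm (k + a + 1)\<close>, which is at most \<open>1\<close>. The estimate
  makes the L1 norms of the terms in the Laplace transform comparable to an exponential
  series.\<close>

lemma norm_rGamma_mult_Gamma_Re_le:
  assumes "Re a > -1"
  shows "norm (rGamma (of_nat k + a + 1)) * Gamma (real k + Re a + 1)
           \<le> norm (rGamma (a + 1)) * Gamma (Re a + 1)"
proof (induction k)
  case 0
  show ?case by (simp only: of_nat_0 add_0_left order_refl)
next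
  case (Suc k)
  let ?s = "of_nat k + a + 1"
  have Re: "Re ?s = real k + Re a + 1" by simp
  have s: "real k + Re a + 1 > 0" using assms by simp
  have norm: "real k + Re a + 1 \<le> norm ?s"
    unfolding Re [symmetric] by (rule complex_Re_le_cmod)
  with s have pos: "norm ?s > 0" by linarith
  then have "rGamma (of_nat (Suc k) + a + 1) = rGamma ?s / ?s"
    using rGamma_plus1[of ?s] by (simp add: field_simps)
  moreover have "Gamma (real (Suc k) + Re a + 1) = (real k + Re a + 1) * Gamma (real k + Re a + 1)"
  proof -
    have "real k + Re a + 1 \<notin> \<int>\<^sub>\<le>\<^sub>0"
      using s by (metis nonpos_Ints_nonpos not_le)
    from Gamma_plus1[OF this] show ?thesis by (simp add: add_ac)
  qed
  ultimately have "norm (rGamma (of_nat (Suc k) + a + 1)) * Gamma (real (Suc k) + Re a + 1)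
     = (real k + Re a + 1) / norm ?s * (norm (rGamma ?s) * Gamma (real k + Re a + 1))"
    by (simp only: norm_divide times_divide_eq_left times_divide_eq_right mult_ac)
  also have "\<dots> \<le> 1 * (norm (rGamma ?s) * Gamma (real k + Re a + 1))"
  proof (rule mult_right_mono)
    show "(real k + Re a + 1) / norm ?s \<le> 1"
      using norm pos by (simp only: divide_le_eq_1_pos)
    show "0 \<le> norm (rGamma ?s) * Gamma (real k + Re a + 1)"
      using Gamma_real_pos[OF s] by (simp only: mult_nonneg_nonneg norm_ge_zero less_imp_le)
  qed
  finally show ?case using Suc by (simp only: mult_1_left)
qed

text \<open>Termwise integration: the \<open>Gamma\<close> value from the integral of the
  \<open>k\<close>-th term cancels the \<open>rGamma\<close> of its coefficient, and what is left is
  the exponential series at \<open>- b / p\<close>. The interchange needs summable L1 norms; they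
  are compared with the series of \<open>exp (\<bar>b\<bar> / p)\<close>.\<close>

lemma laplace_transform_bessel_clifford:
  fixes a :: complex and b p :: real
  assumes a: "Re a > -1" and p: "p > 0"
  shows "has_bochner_integral lborel_pos
           (\<lambda>t. of_real t powr a * bessel_clifford a (- of_real (b * t)) * of_real (exp (- (p * t))))
           (of_real p powr (- a - 1) * of_real (exp (- b / p)))"
proof -
  let ?c = "\<lambda>k. rGamma (of_nat k + a + 1) / fact k * (- of_real b) ^ k :: complex"
  \<comment> \<open>The exponent keeps the shape \<open>s - 1\<close> with
    \<open>s = of_nat k + a + 1\<close>, to match the Gamma integral.\<close>
  let ?e = "\<lambda>k t. of_real t powr (of_nat k + a + 1 - 1) * of_real (exp (- (p * t))) :: complex"
  have e_eq: "?e k t = of_real t powr a * of_real t ^ k * of_real (exp (- (p * t)))"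
    if "t > 0" for k t
    unfolding add_diff_cancel_right' using that by (simp add: powr_add powr_nat')
  have *: "has_bochner_integral lborel_pos (?e k)
      (Gamma (of_nat k + a + 1) * of_real p powr (- (of_nat k + a + 1)))" for k
    by (rule has_bochner_integral_Gamma) (use a p in auto)
  then have int: "has_bochner_integral lborel_pos (\<lambda>t. ?c k * ?e k t)
      (?c k * (Gamma (of_nat k + a + 1) * of_real p powr (- (of_nat k + a + 1))))" for k
    by (rule has_bochner_integral_mult_right)
  have coeff: "?c k * (Gamma (of_nat k + a + 1) * of_real p powr (- (of_nat k + a + 1)))
      = of_real p powr (- a - 1) * ((of_real (- b / p)) ^ k /\<^sub>R fact k)" for k
  proof -
    have "Re (of_nat k + a + 1) > 0" using a by simp
    then have "of_nat k + a + 1 \<notin> \<int>\<^sub>\<le>\<^sub>0"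
      by (auto elim!: nonpos_Ints_cases simp del: plus_complex.sel)
    then have 1: "rGamma (of_nat k + a + 1) * Gamma (of_nat k + a + 1) = 1"
      by (simp add: rGamma_inverse_Gamma Gamma_eq_zero_iff)
    have 2: "of_real p powr (- (of_nat k + a + 1)) = of_real p powr (- a - 1) / of_real p ^ k"
    proof -
      have "- (of_nat k + a + 1) = (- a - 1) - of_nat k" by simp
      moreover have "complex_of_real p powr of_nat k = of_real p ^ k"
        using p by (simp add: powr_nat')
      ultimately show ?thesis by (simp only: powr_diff[of "of_real p" "- a - 1" "of_nat k"])
    qed
    have 3: "(of_real (- b / p)) ^ k /\<^sub>R fact k = ((- of_real b) ^ k / of_real p ^ k / fact k :: complex)"
      by (simp only: of_real_divide of_real_minus power_divide scaleR_conv_of_real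
            of_real_inverse of_real_fact inverse_eq_divide times_divide_eq_left mult_1_left of_real_1)
    have "?c k * (Gamma (of_nat k + a + 1) * (of_real p powr (- a - 1) / of_real p ^ k))
        = (rGamma (of_nat k + a + 1) * Gamma (of_nat k + a + 1)) *
          (of_real p powr (- a - 1) * ((- of_real b) ^ k / of_real p ^ k / fact k))"
      by (simp only: divide_inverse mult_ac)
    then show ?thesis
      unfolding 1 2 3 by (simp only: mult_1_left)
  qed
  have norm_int: "(LINT t|lborel_pos. norm (?c k * ?e k t))
      = norm (?c k) * (Gamma (real k + Re a + 1) * p powr (- (real k + Re a + 1)))" for k
  proof -
    have "(LINT t|lborel_pos. norm (?c k * ?e k t))
        = (LINT t|lborel_pos. norm (?c k) * (t powr (real k + Re a + 1 - 1) * exp (- (p * t))))"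
    proof (rule Bochner_Integration.integral_cong[OF refl])
      fix t assume "t \<in> space lborel_pos"
      then have "norm (of_real t powr (of_nat k + a + 1 - 1)) = t powr (real k + Re a + 1 - 1)"
        by (subst norm_powr_real_powr) simp_all
      then show "norm (?c k * ?e k t) = norm (?c k) * (t powr (real k + Re a + 1 - 1) * exp (- (p * t)))"
        by (simp only: norm_mult norm_of_real abs_exp_cancel)
    qed
    also have "\<dots> = norm (?c k) * (Gamma (real k + Re a + 1) * p powr (- (real k + Re a + 1)))"
    proof -
      have "real k + Re a + 1 > 0" using a by simp
      from has_bochner_integral_Gamma_real[OF this p] show ?thesis
        by (simp only: has_bochner_integral_iff integral_mult_right_zero)
    qed
    finally show ?thesis .
  qed
  have sumint: "summable (\<lambda>k. LINT t|lborel_pos. norm (?c k * ?e k t))"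
  proof (rule summable_comparison_test')
    let ?C = "norm (rGamma (a + 1)) * Gamma (Re a + 1)"
    show "summable (\<lambda>k. ?C * p powr (- Re a - 1) * (inverse (fact k) * (\<bar>b\<bar> / p) ^ k))"
      by (intro summable_mult summable_exp)
    fix k :: nat
    have "norm (LINT t|lborel_pos. norm (?c k * ?e k t))
        = (norm (rGamma (of_nat k + a + 1)) * Gamma (real k + Re a + 1)) *
          (p powr (- Re a - 1) * (inverse (fact k) * (\<bar>b\<bar> / p) ^ k))"
    proof -
      have "p powr (- (real k + Re a + 1)) = p powr (- Re a - 1) / p ^ k"
      proof -
        have "- (real k + Re a + 1) = (- Re a - 1) - real k" by simp
        moreover have "p powr real k = p ^ k" using p by (simp add: powr_realpow)
        ultimately show ?thesis by (simp only: powr_diff[of p "- Re a - 1" "real k"])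
      qed
      moreover have "norm (?c k) = norm (rGamma (of_nat k + a + 1)) / fact k * \<bar>b\<bar> ^ k"
        by (simp only: norm_mult norm_divide norm_power norm_minus_cancel norm_of_real norm_fact)
      moreover have "norm (LINT t|lborel_pos. norm (?c k * ?e k t))
          = (LINT t|lborel_pos. norm (?c k * ?e k t))"
        by (simp only: real_norm_def abs_of_nonneg Bochner_Integration.integral_nonneg norm_ge_zero)
      ultimately show ?thesis
        unfolding norm_int power_divide by (simp only: divide_inverse mult_ac)
    qed
    also have "\<dots> \<le> ?C * (p powr (- Re a - 1) * (inverse (fact k) * (\<bar>b\<bar> / p) ^ k))"
      using p by (intro mult_right_mono norm_rGamma_mult_Gamma_Re_le a) auto
    finally show "norm (LINT t|lborel_pos. norm (?c k * ?e k t))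
        \<le> ?C * p powr (- Re a - 1) * (inverse (fact k) * (\<bar>b\<bar> / p) ^ k)"
      by (simp only: mult.assoc)
  qed
  have term_eq: "?c k * ?e k t = (rGamma (of_nat k + a + 1) / fact k * (- of_real (b * t)) ^ k) *
      (of_real t powr a * of_real (exp (- (p * t))))" if "t > 0" for k t
  proof -
    have "(- of_real (b * t)) ^ k = (- of_real b) ^ k * (of_real t ^ k :: complex)"
      by (simp only: of_real_mult power_mult_distrib flip: mult_minus_left)
    then show ?thesis
      unfolding e_eq[OF that] by (simp only: mult_ac)
  qed
  have ae: "AE t in lborel_pos. summable (\<lambda>k. norm (?c k * ?e k t))"
  proof (rule AE_I2)
    fix t assume "t \<in> space lborel_pos"
    then have "(\<lambda>k. norm (?c k * ?e k t))
        = (\<lambda>k. norm (rGamma (of_nat k + a + 1) / fact k * (- of_real (b * t)) ^ k) *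
            norm (of_real t powr a * of_real (exp (- (p * t))) :: complex))"
      by (simp only: space_lborel_pos greaterThan_iff term_eq norm_mult)
    then show "summable (\<lambda>k. norm (?c k * ?e k t))"
      by (simp only:) (intro summable_mult2 summable_norm_bessel_clifford)
  qed
  have ints: "integrable lborel_pos (\<lambda>t. ?c k * ?e k t)" for k
    using int[of k] by (rule integrable.intros)
  define g where "g = (\<lambda>k t. ?c k * ?e k t)"
  note sums' = sums_integral[of lborel_pos g, unfolded g_def, OF ints ae sumint]
  note integrable' = integrable_suminf[of lborel_pos g, unfolded g_def, OF ints ae sumint]
  have "(\<lambda>k. LINT t|lborel_pos. ?c k * ?e k t) sums (LINT t|lborel_pos. (\<Sum>k. ?c k * ?e k t))"
    by (rule sums')
  then have "(\<lambda>k. of_real p powr (- a - 1) * ((of_real (- b / p)) ^ k /\<^sub>R fact k))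
      sums (LINT t|lborel_pos. (\<Sum>k. ?c k * ?e k t))"
    using int by (simp only: has_bochner_integral_iff coeff)
  moreover have "(\<lambda>k. of_real p powr (- a - 1) * ((of_real (- b / p)) ^ k /\<^sub>R fact k))
      sums (of_real p powr (- a - 1) * exp (of_real (- b / p)))"
    by (intro sums_mult exp_converges)
  ultimately have "(LINT t|lborel_pos. (\<Sum>k. ?c k * ?e k t))
      = of_real p powr (- a - 1) * exp (of_real (- b / p))"
    by (rule sums_unique2)
  with integrable'
  have "has_bochner_integral lborel_pos (\<lambda>t. \<Sum>k. ?c k * ?e k t)
      (of_real p powr (- a - 1) * of_real (exp (- b / p)))"
    unfolding has_bochner_integral_iff exp_of_real by blast
  also have "?this \<longleftrightarrow> ?thesis"
  proof (rule has_bochner_integral_cong)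
    fix t assume t: "t \<in> space lborel_pos"
    have "(\<Sum>k. ?c k * ?e k t) = (\<Sum>k. (rGamma (of_nat k + a + 1) / fact k * (- of_real (b * t)) ^ k) *
      (of_real t powr a * of_real (exp (- (p * t)))))"
      using t by (simp only: space_lborel_pos greaterThan_iff term_eq)
    also have "\<dots> = bessel_clifford a (- of_real (b * t)) * (of_real t powr a * of_real (exp (- (p * t))))"
      unfolding bessel_clifford_def by (rule suminf_mult2[OF summable_bessel_clifford, symmetric])
    finally show "(\<Sum>k. ?c k * ?e k t)
      = of_real t powr a * bessel_clifford a (- of_real (b * t)) * of_real (exp (- (p * t)))"
      by (simp only: mult_ac)
  qed simp_all
  finally show ?thesis .
qed

section \<open>The Macdonald-type integral\<close>

text \<open>Near \<open>0\<close> the factor \<open>exp (- \<kappa> / q)\<close> beats every power: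
  \<open>1 + y \<le> exp y\<close> at \<open>y = \<kappa> / (n * q)\<close>, raised to the power
  \<open>n\<close>, bounds it by a multiple of \<open>q ^ n\<close>.\<close>

lemma integrable_powr_mult_exp:
  fixes r \<kappa> :: real
  assumes "\<kappa> > 0"
  shows "integrable lborel_pos (\<lambda>q. q powr r * exp (- q - \<kappa> / q))"
proof -
  \<comment> \<open>\<open>n > - r - 1\<close> makes \<open>q powr (r + n) * exp (- q)\<close> a
    Gamma integrand; \<open>n > 0\<close> permits the division by \<open>n\<close>.\<close>
  obtain n :: nat where n: "real n > - r - 1" "n > 0"
    by (metis reals_Archimedean2 gr0I less_trans of_nat_0_less_iff neq0_conv not_less order.strict_trans2)
  have "integrable lborel_pos (\<lambda>q. (real n / \<kappa>) ^ n * (q powr (r + real n + 1 - 1) * exp (- (1 * q))))"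
    by (intro integrable_mult_right integrable.intros[OF has_bochner_integral_Gamma_real])
       (use n in auto)
  then show ?thesis
  proof (rule Bochner_Integration.integrable_bound)
    show "(\<lambda>q. q powr r * exp (- q - \<kappa> / q)) \<in> borel_measurable lborel_pos"
      by (intro borel_measurable_lborel_pos continuous_intros) auto
    show "AE q in lborel_pos. norm (q powr r * exp (- q - \<kappa> / q))
        \<le> norm ((real n / \<kappa>) ^ n * (q powr (r + real n + 1 - 1) * exp (- (1 * q))))"
    proof (rule AE_I2)
      fix q :: real assume "q \<in> space lborel_pos"
      then have q: "q > 0" by simp
      have "(\<kappa> / (real n * q)) ^ n \<le> exp (\<kappa> / (real n * q)) ^ n"
        using assms q exp_ge_add_one_self[of "\<kappa> / (real n * q)"]
        by (intro power_mono) (auto intro!: divide_nonneg_nonneg simp del: exp_ge_add_one_self)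
      also have "\<dots> = exp (\<kappa> / q)"
        using n by (simp flip: exp_of_nat_mult)
      finally have "(\<kappa> / (real n * q)) ^ n \<le> exp (\<kappa> / q)" .
      then have "1 / exp (\<kappa> / q) \<le> 1 / (\<kappa> / (real n * q)) ^ n"
        using assms q n by (intro divide_left_mono) auto
      also have "\<dots> = (real n / \<kappa>) ^ n * q ^ n"
        by (simp add: power_divide power_mult_distrib)
      finally have "exp (- (\<kappa> / q)) \<le> (real n / \<kappa>) ^ n * q ^ n"
        by (simp add: exp_minus inverse_eq_divide)
      then have "q powr r * exp (- q) * exp (- (\<kappa> / q))
          \<le> q powr r * exp (- q) * ((real n / \<kappa>) ^ n * q ^ n)"
        by (intro mult_left_mono) auto
      also have "\<dots> = (real n / \<kappa>) ^ n * (q powr (r + real n) * exp (- q))"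
        using q by (simp add: powr_add powr_realpow)
      finally show "norm (q powr r * exp (- q - \<kappa> / q))
          \<le> norm ((real n / \<kappa>) ^ n * (q powr (r + real n + 1 - 1) * exp (- (1 * q))))"
        using assms by (simp add: exp_diff exp_minus field_simps)
    qed
  qed
qed

definition K_kernel :: "complex \<Rightarrow> complex \<Rightarrow> real \<Rightarrow> complex" where
  "K_kernel s c q = of_real q powr (- s - 1) * exp (- of_real q - c / of_real q)"

text \<open>For \<open>Re c > 0\<close> this is \<open>2 * c powr (- s / 2)\<close> times the
  Macdonald function of order \<open>s\<close> at \<open>2 * sqrt c\<close>. In this normalisation
  \<open>c\<close> occurs in one exponential only, so that differentiation in \<open>c\<close> just
  raises the order and changes the sign.\<close>

definition K_integral :: "complex \<Rightarrow> complex \<Rightarrow> complex" where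
  "K_integral s c = (LINT q|lborel_pos. K_kernel s c q)"

lemma continuous_on_K_kernel: "continuous_on {0<..} (K_kernel s c)"
  unfolding K_kernel_def
  by (intro continuous_intros) (auto simp: complex_nonpos_Reals_iff)

lemmas borel_measurable_K_kernel = borel_measurable_lborel_pos[OF continuous_on_K_kernel]

lemma norm_K_kernel:
  "q > 0 \<Longrightarrow> norm (K_kernel s c q) = q powr (- Re s - 1) * exp (- q - Re c / q)"
  by (simp add: K_kernel_def norm_mult norm_powr_real_powr)

lemma K_kernel_Suc: "q > 0 \<Longrightarrow> K_kernel (s + 1) c q = K_kernel s c q / of_real q"
  by (simp add: K_kernel_def powr_diff powr_minus field_simps power2_eq_square)

lemma integrable_K_kernel:
  assumes "Re c > 0"
  shows "integrable lborel_pos (K_kernel s c)"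
proof (rule Bochner_Integration.integrable_bound)
  show "integrable lborel_pos (\<lambda>q. q powr (- Re s - 1) * exp (- q - Re c / q))"
    using assms by (rule integrable_powr_mult_exp)
  show "AE q in lborel_pos. norm (K_kernel s c q) \<le> norm (q powr (- Re s - 1) * exp (- q - Re c / q))"
    by (intro AE_I2) (simp add: norm_K_kernel)
qed (rule borel_measurable_K_kernel)

lemma has_field_derivative_K_kernel:
  assumes "q > 0"
  shows "((\<lambda>c. K_kernel s c q) has_field_derivative - K_kernel (s + 1) c q) (at c)"
  unfolding K_kernel_Suc[OF assms] unfolding K_kernel_def
  using assms by (auto intro!: derivative_eq_intros)

lemma has_field_derivative_K_integral:
  assumes c: "Re c > 0"
  shows "(K_integral s has_field_derivative - K_integral (s + 1) c) (at c)"
proof -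
  \<comment> \<open>On this ball \<open>Re z\<close> stays at least \<open>Re c / 2\<close>, so the
    modulus of the kernel with \<open>Re c / 2\<close> in place of \<open>Re z\<close> is a common
    integrable majorant.\<close>
  have Re_ge: "Re z \<ge> Re c / 2" if "z \<in> ball c (Re c / 2)" for z
    using that abs_Re_le_cmod[of "c - z"] by (simp add: dist_norm)
  have "((\<lambda>z. LINT q|lborel_pos. K_kernel s z q) has_field_derivative
      (LINT q|lborel_pos. - K_kernel (s + 1) c q)) (at c)"
  proof (rule has_field_derivative_integral_dominated)
    show "integrable lborel_pos (\<lambda>q. q powr (- Re (s + 1) - 1) * exp (- q - (Re c / 2) / q))"
      using c by (intro integrable_powr_mult_exp) auto
    fix z assume z: "z \<in> ball c (Re c / 2)"
    with Re_ge[of z] c show "integrable lborel_pos (K_kernel s z)"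
      by (intro integrable_K_kernel) auto
    fix q :: real assume "q \<in> space lborel_pos"
    then have q: "q > 0" by simp
    then show "((\<lambda>z. K_kernel s z q) has_field_derivative - K_kernel (s + 1) z q) (at z)"
      by (rule has_field_derivative_K_kernel)
    have "(Re c / 2) / q \<le> Re z / q"
      using q Re_ge[OF z] by (intro divide_right_mono) auto
    then show "norm (- K_kernel (s + 1) z q) \<le> q powr (- Re (s + 1) - 1) * exp (- q - (Re c / 2) / q)"
      using q by (auto simp: norm_K_kernel intro!: mult_left_mono)
  qed (use c in \<open>auto intro: borel_measurable_K_kernel\<close>)
  then show ?thesis
    by (simp add: K_integral_def [abs_def])
qed

text \<open>The derivative of \<open>q powr (- s) * exp (- q - c / q)\<close> is a combination of
  the kernels of orders \<open>s\<close>, \<open>s - 1\<close> and \<open>s + 1\<close>; its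
  integral is zero because that function vanishes at both ends.\<close>

lemma K_integral_recurrence:
  assumes c: "Re c > 0"
  shows "c * K_integral (s + 1) c = s * K_integral s c + K_integral (s - 1) c"
proof -
  define F where "F = (\<lambda>q::real. of_real q powr (- s) * exp (- of_real q - c / of_real q))"
  define f where "f = (\<lambda>q. - s * K_kernel s c q - K_kernel (s - 1) c q + c * K_kernel (s + 1) c q)"
  have int: "integrable lborel_pos f"
    unfolding f_def using c
    by (intro Bochner_Integration.integrable_add Bochner_Integration.integrable_diff
          integrable_mult_right integrable_K_kernel)
  have F': "(F has_vector_derivative f q) (at q)" if q: "q > 0" for q
  proof -
    have "of_real q \<notin> (\<real>\<^sub>\<le>\<^sub>0 :: complex set)"
      using q by (auto simp: complex_nonpos_Reals_iff)
    then have "((\<lambda>z. z powr (- s) * exp (- z - c / z)) has_field_derivative f q) (at (of_real q))"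
      unfolding f_def K_kernel_def using q
      by (auto intro!: derivative_eq_intros simp: powr_diff powr_minus powr_add field_simps power2_eq_square)
    from has_vector_derivative_real_field[OF this] show ?thesis
      unfolding F_def .
  qed
  have norm_F: "norm (F q) = q powr (- Re s) * exp (- q - Re c / q)" if "q > 0" for q
    using that by (simp add: F_def norm_mult norm_powr_real_powr)
  have F0: "(F \<longlongrightarrow> 0) (at_right 0)"
  proof (rule tendsto_norm_zero_cancel)
    have "((\<lambda>q. q powr (- Re s) * exp (- q - Re c / q)) \<longlongrightarrow> 0) (at_right 0)"
      using c by real_asymp
    then show "((\<lambda>q. norm (F q)) \<longlongrightarrow> 0) (at_right 0)"
      by (rule Lim_transform_eventually)
         (auto intro!: eventually_mono[OF eventually_at_right_less] simp: norm_F)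
  qed
  have F1: "(F \<longlongrightarrow> 0) at_top"
  proof (rule tendsto_norm_zero_cancel)
    have "((\<lambda>q. q powr (- Re s) * exp (- q - Re c / q)) \<longlongrightarrow> 0) at_top"
      using c by real_asymp
    then show "((\<lambda>q. norm (F q)) \<longlongrightarrow> 0) at_top"
      by (rule Lim_transform_eventually)
         (auto intro!: eventually_mono[OF eventually_gt_at_top[of 0]] simp: norm_F)
  qed
  have "(LBINT q=0..\<infinity>. f q) = 0 - 0"
  proof (rule interval_integral_FTC_integrable)
    show "set_integrable lborel (einterval 0 \<infinity>) f"
      using int by (simp add: set_integrable_def integrable_restrict_space einterval_eq zero_ereal_def)
    show "isCont f q" if "0 < ereal q" for q
    proof -
      have "continuous_on {0<..} f"
        unfolding f_def by (intro continuous_intros continuous_on_K_kernel)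
      then show ?thesis using that by (simp add: continuous_on_eq_continuous_at)
    qed
    show "((F \<circ> real_of_ereal) \<longlongrightarrow> 0) (at_right 0)"
      using F0 by (simp add: ereal_tendsto_simps zero_ereal_def)
    show "((F \<circ> real_of_ereal) \<longlongrightarrow> 0) (at_left \<infinity>)"
      using F1 by (simp add: ereal_tendsto_simps)
  qed (use F' in auto)
  then have "(LINT q|lborel_pos. f q) = 0"
    by (simp add: interval_lebesgue_integral_0_infty set_lebesgue_integral_def integral_restrict_space)
  moreover have "(LINT q|lborel_pos. f q)
      = - s * K_integral s c - K_integral (s - 1) c + c * K_integral (s + 1) c"
    unfolding f_def K_integral_def using integrable_K_kernel[OF c] by simp
  ultimately show ?thesis by (simp add: algebra_simps)
qed

text \<open>The substitution \<open>q -> c / q\<close> exchanges the two terms of the exponent; this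
  is the evenness of the Macdonald function in its order.\<close>

lemma K_integral_minus:
  fixes c :: real
  assumes c: "c > 0"
  shows "K_integral (- s) (of_real c) = of_real c powr s * K_integral s (of_real c)"
proof -
  have "bij_betw ((/) c) {0<..} {0<..}"
    by (rule bij_betw_byWitness[where f' = "(/) c"]) (use c in auto)
  moreover have "((/) c has_real_derivative - c / t\<^sup>2) (at t)" if "t > 0" for t :: real
    using that by (auto intro!: derivative_eq_intros simp: power2_eq_square)
  moreover have "continuous_on {0<..} (\<lambda>t::real. - c / t\<^sup>2)"
    by (auto intro!: continuous_intros)
  ultimately have "has_bochner_integral lborel_pos
      (\<lambda>t. \<bar>- c / t\<^sup>2\<bar> *\<^sub>R K_kernel (- s) (of_real c) (c / t)) (K_integral (- s) (of_real c))"
    unfolding K_integral_def using c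
    by (intro has_bochner_integral_lborel_pos_substitute has_bochner_integral_integrable
          integrable_K_kernel continuous_on_K_kernel) auto
  also have "?this \<longleftrightarrow> has_bochner_integral lborel_pos
      (\<lambda>t. of_real c powr s * K_kernel s (of_real c) t) (K_integral (- s) (of_real c))"
  proof (rule has_bochner_integral_cong)
    fix t assume "t \<in> space lborel_pos"
    then have t: "t > 0" by simp
    have "of_real c powr s = (of_real (c / t) powr s * of_real t powr s :: complex)"
      using powr_times_real[of "of_real (c / t)" "of_real t" s] c t by simp
    moreover have "- of_real (c / t) - of_real c / of_real (c / t)
        = (- of_real t - of_real c / of_real t :: complex)"
      using c t by simp
    ultimately show "\<bar>- c / t\<^sup>2\<bar> *\<^sub>R K_kernel (- s) (of_real c) (c / t)
        = of_real c powr s * K_kernel s (of_real c) t"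
      unfolding K_kernel_def using c t
      by (simp add: powr_diff powr_minus scaleR_conv_of_real power2_eq_square
            minus_diff_commute inverse_eq_divide)
  qed simp_all
  finally show ?thesis
    by (simp add: has_bochner_integral_iff K_integral_def)
qed

text \<open>As \<open>c\<close> tends to \<open>0\<close> the kernel of order \<open>- s\<close>
  becomes the integrand of \<open>Gamma s\<close>, which also dominates it since
  \<open>exp (- c / q) \<le> 1\<close>.\<close>

lemma tendsto_K_integral:
  assumes s: "Re s > 0"
  shows "((\<lambda>c. K_integral (- s) (of_real c)) \<longlongrightarrow> Gamma s) (at_right 0)"
proof -
  let ?f = "\<lambda>q. of_real q powr (s - 1) * of_real (exp (- (1 * q))) :: complex"
  have G: "has_bochner_integral lborel_pos ?f (Gamma s * of_real 1 powr (- s))"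
    by (rule has_bochner_integral_Gamma) (use s in auto)
  have f: "?f \<in> borel_measurable lborel_pos" and "integrable lborel_pos (\<lambda>q. norm (?f q))"
    using G by (auto simp: has_bochner_integral_iff)
  have "((\<lambda>c. LINT q|lborel_pos. K_kernel (- s) (of_real c) q) \<longlongrightarrow> (LINT q|lborel_pos. ?f q)) (at_right 0)"
  proof (rule tendsto_integral_dominated)
    show "\<forall>\<^sub>F c in at_right 0. \<forall>q\<in>space lborel_pos. norm (K_kernel (- s) (of_real c) q) \<le> norm (?f q)"
      using eventually_at_right_less
    proof eventually_elim
      case (elim c)
      then show ?case
        by (auto simp: norm_K_kernel norm_mult norm_powr_real_powr intro!: mult_left_mono)
    qed
    fix q assume "q \<in> space lborel_pos"
    then have "isCont (\<lambda>c. K_kernel (- s) (of_real c) q) 0"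
      unfolding K_kernel_def by (intro continuous_intros) auto
    then have "((\<lambda>c. K_kernel (- s) (of_real c) q) \<longlongrightarrow> K_kernel (- s) (of_real 0) q) (at_right 0)"
      unfolding isCont_def by (rule tendsto_within_subset) auto
    then show "((\<lambda>c. K_kernel (- s) (of_real c) q) \<longlongrightarrow> ?f q) (at_right 0)"
      by (simp add: K_kernel_def exp_of_real flip: of_real_minus)
  qed (fact | simp add: borel_measurable_K_kernel)+
  also have "(LINT q|lborel_pos. ?f q) = Gamma s"
    using has_bochner_integral_integral_eq[OF G] by simp
  finally show ?thesis
    by (simp add: K_integral_def)
qed

section \<open>Wronskians and the connection formula\<close>

lemma at_right_of_real:
  "isCont f (0::complex) \<Longrightarrow> ((\<lambda>c. f (of_real c)) \<longlongrightarrow> f 0) (at_right 0)"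
  by (rule isCont_tendsto_compose) (auto intro!: tendsto_eq_intros)

text \<open>For Wronskians whose factors need not extend to \<open>0\<close>: the half-plane is
  convex, so the function is constant there, and the constant is seen along the positive
  reals.\<close>

lemma constant_on_right_half_plane:
  fixes f :: "complex \<Rightarrow> complex"
  assumes deriv: "\<And>c. Re c > 0 \<Longrightarrow> (f has_field_derivative 0) (at c)"
    and lim: "((\<lambda>x. f (of_real x)) \<longlongrightarrow> L) (at_right 0)"
    and c: "Re c > 0"
  shows "f c = L"
proof -
  have "\<exists>k. \<forall>z\<in>{z. Re z > 0}. f z = k"
    by (rule has_field_derivative_zero_constant)
       (auto intro: convex_halfspace_Re_gt has_field_derivative_at_within deriv)
  then obtain k where k: "\<And>z. Re z > 0 \<Longrightarrow> f z = k" by auto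
  have "((\<lambda>x. f (of_real x)) \<longlongrightarrow> k) (at_right 0)"
    by (rule Lim_transform_eventually[OF tendsto_const])
       (auto intro: eventually_mono[OF eventually_at_right_less] simp: k)
  with lim have "k = L"
    by (intro tendsto_unique[OF trivial_limit_at_right_real])
  with k c show ?thesis by simp
qed

text \<open>
  Both sides solve \<open>c y'' + (a + 1) y' = y\<close>. The functions \<open>W1\<close>, \<open>W2\<close>, \<open>W3\<close> are the
  Wronskians, multiplied by \<open>c powr (a + 1)\<close>, of the pairs formed from \<open>K_integral a\<close>,
  \<open>bessel_clifford a\<close> and \<open>c powr (- a) * bessel_clifford (- a) c\<close>; they are constant, and their
  values are read off as \<open>c\<close> tends to \<open>0\<close>.
\<close>

lemma K_integral_conv_bessel_clifford:
  assumes a: "- 1 < Re a" "Re a < 0" and c: "Re c > 0"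
  shows "K_integral a c * (rGamma (a + 1) * rGamma (- a))
           = bessel_clifford a c - c powr (- a) * bessel_clifford (- a) c"
proof -
  let ?B = bessel_clifford and ?K = K_integral
  have rec1: "z * ?B (a + 2) z = ?B a z - (a + 1) * ?B (a + 1) z" for z
    using bessel_clifford_recurrence[of z a] by (simp add: algebra_simps)
  have rec2: "z * ?B (1 - a) z = ?B (- a - 1) z + a * ?B (- a) z" for z
    using bessel_clifford_recurrence[of z "- a - 1"] by (simp add: algebra_simps)
  have rec3: "z * ?K (a + 2) z = (a + 1) * ?K (a + 1) z + ?K a z" if "Re z > 0" for z
    using K_integral_recurrence[OF that, of "a + 1"] by (simp add: add.assoc)
  have DK: "(?K a has_field_derivative - ?K (a + 1) z) (at z)"
      "(?K (a + 1) has_field_derivative - ?K (a + 2) z) (at z)" if "Re z > 0" for z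
    using has_field_derivative_K_integral[OF that, of a]
      has_field_derivative_K_integral[OF that, of "a + 1"] by (simp_all add: add.assoc)
  have DB: "(?B a has_field_derivative ?B (a + 1) z) (at z)"
      "(?B (a + 1) has_field_derivative ?B (a + 2) z) (at z)"
      "(?B (- a) has_field_derivative ?B (1 - a) z) (at z)"
      "(?B (- a - 1) has_field_derivative ?B (- a) z) (at z)" for z
    using has_field_derivative_bessel_clifford[of a z] has_field_derivative_bessel_clifford[of "a + 1" z]
      has_field_derivative_bessel_clifford[of "- a" z] has_field_derivative_bessel_clifford[of "- a - 1" z]
    by (simp_all add: add.assoc add.commute)
  have limB: "((\<lambda>x. ?B s (of_real x)) \<longlongrightarrow> rGamma (s + 1)) (at_right 0)" for s
    using at_right_of_real[OF isCont_bessel_clifford] by simp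
  have limK: "((\<lambda>x. ?K s (of_real x)) \<longlongrightarrow> Gamma (- s)) (at_right 0)" if "Re s < 0" for s
    using tendsto_K_integral[of "- s"] that by simp
  have Gamma1: "Gamma z * rGamma z = 1" if "Re z > 0" for z :: complex
  proof -
    have "z \<notin> \<int>\<^sub>\<le>\<^sub>0" using that by (auto elim!: nonpos_Ints_cases)
    then show ?thesis by (simp add: rGamma_inverse_Gamma Gamma_eq_zero_iff)
  qed

  define W1 where "W1 = (\<lambda>z. z powr (a + 1) * (?K a z * ?B (a + 1) z + ?K (a + 1) z * ?B a z))"
  have W1: "W1 c = 1"
  proof (rule constant_on_right_half_plane[OF _ _ c])
    fix z :: complex assume z: "Re z > 0"
    then have nz: "z \<notin> \<real>\<^sub>\<le>\<^sub>0" "z \<noteq> 0"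
      by (auto simp: complex_nonpos_Reals_iff)
    have DP: "((\<lambda>z. z powr (a + 1)) has_field_derivative (a + 1) * z powr (a + 1 - 1)) (at z)"
      using nz(1) by (rule has_field_derivative_powr)
    let ?d = "(a + 1) * z powr (a + 1 - 1) * (?K a z * ?B (a + 1) z + ?K (a + 1) z * ?B a z) +
        (((- ?K (a + 1) z) * ?B (a + 1) z + ?B (a + 2) z * ?K a z) +
        ((- ?K (a + 2) z) * ?B a z + ?B (a + 1) z * ?K (a + 1) z)) * z powr (a + 1)"
    have "(W1 has_field_derivative ?d) (at z)"
      unfolding W1_def by (intro DERIV_add DERIV_mult DP DK[OF z] DB)
    also have "?d = z powr a * (?K a z * (z * ?B (a + 2) z) - (z * ?K (a + 2) z) * ?B a z
        + (a + 1) * (?K a z * ?B (a + 1) z + ?K (a + 1) z * ?B a z))"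
      using nz by (simp add: powr_add algebra_simps)
    also have "\<dots> = 0"
      unfolding rec1 rec3[OF z] by (simp add: algebra_simps)
    finally show "(W1 has_field_derivative 0) (at z)" .
  next
    \<comment> \<open>\<open>K_integral (a + 1)\<close> is unbounded at \<open>0\<close>, but
      together with the factor \<open>x powr (a + 1)\<close> it is
      \<open>K_integral (- (a + 1))\<close>, which tends to \<open>Gamma (a + 1)\<close>. The other
      product keeps a power that tends to \<open>0\<close> because
      \<open>Re a > - 1\<close>.\<close>
    have "((\<lambda>x. of_real x powr (a + 1) * ?K a (of_real x) * ?B (a + 1) (of_real x)
        + ?K (- (a + 1)) (of_real x) * ?B a (of_real x))
        \<longlongrightarrow> 0 * Gamma (- a) * rGamma (a + 1 + 1) + Gamma (- (- (a + 1))) * rGamma (a + 1)) (at_right 0)"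
    proof (intro tendsto_intros limB limK)
      have "((\<lambda>x. x powr Re (a + 1)) \<longlongrightarrow> 0) (at_right 0)"
        using a by real_asymp
      then have "((\<lambda>x. norm (complex_of_real x powr (a + 1))) \<longlongrightarrow> 0) (at_right 0)"
        by (rule Lim_transform_eventually)
           (auto intro: eventually_mono[OF eventually_at_right_less] simp: norm_powr_real_powr)
      then show "((\<lambda>x. complex_of_real x powr (a + 1)) \<longlongrightarrow> 0) (at_right 0)"
        by (rule tendsto_norm_zero_cancel)
    qed (use a in auto)
    also have "0 * Gamma (- a) * rGamma (a + 1 + 1) + Gamma (- (- (a + 1))) * rGamma (a + 1) = 1"
      using Gamma1[of "a + 1"] a by (simp add: add.commute)
    finally show "((\<lambda>x. W1 (of_real x)) \<longlongrightarrow> 1) (at_right 0)"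
    proof (rule Lim_transform_eventually)
      show "\<forall>\<^sub>F x in at_right 0. of_real x powr (a + 1) * ?K a (of_real x) * ?B (a + 1) (of_real x)
        + ?K (- (a + 1)) (of_real x) * ?B a (of_real x) = W1 (of_real x)"
        using eventually_at_right_less
      proof eventually_elim
        case (elim x)
        show ?case
          unfolding W1_def K_integral_minus[OF elim] by (simp add: algebra_simps)
      qed
    qed
  qed

  \<comment> \<open>No fractional power is left: by \<open>rec2\<close> the derivative of
    \<open>z powr (- a) * bessel_clifford (- a) z\<close> is
    \<open>z powr (- a - 1) * bessel_clifford (- a - 1) z\<close>, and the multiplier
    \<open>z powr (a + 1)\<close> cancels the branch.\<close>
  define W2 where "W2 = (\<lambda>z. ?K a z * ?B (- a - 1) z + z * ?K (a + 1) z * ?B (- a) z)"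
  have W2: "W2 c = 1"
  proof (rule constant_on_right_half_plane[OF _ _ c])
    fix z :: complex assume z: "Re z > 0"
    let ?d = "((- ?K (a + 1) z) * ?B (- a - 1) z + ?B (- a) z * ?K a z) +
        ((1 * ?K (a + 1) z + (- ?K (a + 2) z) * z) * ?B (- a) z + ?B (1 - a) z * (z * ?K (a + 1) z))"
    have "(W2 has_field_derivative ?d) (at z)"
      unfolding W2_def by (intro DERIV_add DERIV_mult DERIV_ident DK[OF z] DB)
    also have "?d = - ?K (a + 1) z * ?B (- a - 1) z + ?B (- a) z * ?K a z
        + ?K (a + 1) z * ?B (- a) z - (z * ?K (a + 2) z) * ?B (- a) z
        + (z * ?B (1 - a) z) * ?K (a + 1) z"
      by (simp add: algebra_simps)
    also have "\<dots> = 0"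
      unfolding rec2 rec3[OF z] by (simp add: algebra_simps)
    finally show "(W2 has_field_derivative 0) (at z)" .
  next
    \<comment> \<open>The recurrence replaces \<open>x * K_integral (a + 1) x\<close> by orders
      \<open>a\<close> and \<open>a - 1\<close>, which have negative real part and hence limits;
      these contributions cancel since \<open>Gamma (1 - a) = - a * Gamma (- a)\<close>.\<close>
    have "((\<lambda>x. ?K a (of_real x) * ?B (- a - 1) (of_real x)
        + (a * ?K a (of_real x) + ?K (a - 1) (of_real x)) * ?B (- a) (of_real x))
        \<longlongrightarrow> Gamma (- a) * rGamma (- a - 1 + 1)
          + (a * Gamma (- a) + Gamma (- (a - 1))) * rGamma (- a + 1)) (at_right 0)"
      by (intro tendsto_intros limB limK) (use a in auto)
    also have "Gamma (- a) * rGamma (- a - 1 + 1)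
          + (a * Gamma (- a) + Gamma (- (a - 1))) * rGamma (- a + 1) = 1"
    proof -
      have "- a \<notin> \<int>\<^sub>\<le>\<^sub>0"
        using a by (metis nonpos_Ints_cases neg_0_less_iff_less not_less of_int_0_le_iff
            complex_Re_of_int uminus_complex.sel(1) of_int_le_0_iff)
      then have "Gamma (- (a - 1)) = - a * Gamma (- a)"
        using Gamma_plus1[of "- a"] by (simp add: add.commute)
      then show ?thesis using Gamma1[of "- a"] a by simp
    qed
    finally show "((\<lambda>x. W2 (of_real x)) \<longlongrightarrow> 1) (at_right 0)"
    proof (rule Lim_transform_eventually)
      show "\<forall>\<^sub>F x in at_right 0. ?K a (of_real x) * ?B (- a - 1) (of_real x)
        + (a * ?K a (of_real x) + ?K (a - 1) (of_real x)) * ?B (- a) (of_real x) = W2 (of_real x)"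
        using eventually_at_right_less
      proof eventually_elim
        case (elim x)
        then have "of_real x * ?K (a + 1) (of_real x) = a * ?K a (of_real x) + ?K (a - 1) (of_real x)"
          by (intro K_integral_recurrence) simp
        then show ?case
          by (simp only: W2_def)
      qed
    qed
  qed

  \<comment> \<open>This Wronskian is entire, so its constant value can be read off at
    \<open>0\<close> itself.\<close>
  define W3 where "W3 = (\<lambda>z. ?B a z * ?B (- a - 1) z - z * ?B (a + 1) z * ?B (- a) z)"
  have W3: "W3 c = rGamma (a + 1) * rGamma (- a)"
  proof -
    have "(W3 has_field_derivative 0) (at z)" for z
    proof -
      let ?d = "(?B (a + 1) z * ?B (- a - 1) z + ?B (- a) z * ?B a z) -
        ((1 * ?B (a + 1) z + ?B (a + 2) z * z) * ?B (- a) z + ?B (1 - a) z * (z * ?B (a + 1) z))"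
      have "(W3 has_field_derivative ?d) (at z)"
        unfolding W3_def by (intro DERIV_diff DERIV_mult DERIV_ident DB)
      also have "?d = ?B (a + 1) z * ?B (- a - 1) z + ?B (- a) z * ?B a z
          - ?B (a + 1) z * ?B (- a) z - (z * ?B (a + 2) z) * ?B (- a) z
          - (z * ?B (1 - a) z) * ?B (a + 1) z"
        by (simp add: algebra_simps)
      also have "\<dots> = 0"
        unfolding rec1 rec2 by (simp add: algebra_simps)
      finally show ?thesis .
    qed
    then have "W3 c = W3 0"
      using has_field_derivative_zero_constant[of UNIV W3] by auto
    then show ?thesis by (simp add: W3_def)
  qed

  have nz: "c \<noteq> 0" using c by auto
  then have "c powr (- a) * c powr (a + 1) = c"
    by (simp flip: powr_add)
  then have "c powr (- a) * X * (c powr (a + 1) * Y) = c * X * Y" for X Y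
    by (metis mult.assoc mult.left_commute)
  \<comment> \<open>For any three functions, a determinant with a repeated row gives
    \<open>f W(g,h) = g W(f,h) - h W(f,g)\<close>; here it solves for
    \<open>K_integral a\<close>.\<close>
  then have "?K a c * W3 c = ?B a c * W2 c - c powr (- a) * ?B (- a) c * W1 c"
    unfolding W1_def W2_def W3_def by (simp only:) (simp add: algebra_simps)
  then show ?thesis
    unfolding W1 W2 W3 by simp
qed

section \<open>Principal values and Stieltjes transforms\<close>

text \<open>Oddness kills the integral over an interval symmetric about \<open>x\<close>, the bound
  by \<open>1 / |t - x|\<close> gives a majorant common to a whole family of kernels, and
  boundedness of each single kernel makes its own integrals exist.\<close>

definition odd_kernel :: "real \<Rightarrow> (real \<Rightarrow> real) \<Rightarrow> bool" where
  "odd_kernel x k \<longleftrightarrow> k \<in> borel_measurable borel \<and> bounded (range k) \<and>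
     (\<forall>t. k (2 * x - t) = - k t \<and> \<bar>k t * (t - x)\<bar> \<le> 1)"

text \<open>
  The truncated kernel \<open>1/(t - x)\<close> of the principal value and the real part of the Cauchy kernel
  are both odd about \<open>x\<close>. Subtracting \<open>h x\<close> near \<open>x\<close> therefore turns both integrals into
  integrals against one absolutely integrable function, which is why they have the same limit.
\<close>

lemma odd_kernel_integral:
  fixes h :: "real \<Rightarrow> complex"
  assumes "x > 0"
    and meas: "h \<in> borel_measurable lborel_pos"
    and int: "integrable lborel_pos (\<lambda>t. h t / of_real (1 + t))"
    and diff: "((\<lambda>t. (h t - h x) / of_real (t - x)) \<longlongrightarrow> D) (at x)"
  obtains L where
    "\<forall>k. odd_kernel x k \<longrightarrow> integrable lborel_pos (\<lambda>t. h t * of_real (k t))"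
    "\<forall>k. (\<forall>e>0. odd_kernel x (k e)) \<and>
         (\<forall>t. t \<noteq> x \<longrightarrow> ((\<lambda>e. k e t) \<longlongrightarrow> 1 / (t - x)) (at_right (0::real))) \<longrightarrow>
      ((\<lambda>e. LINT t|lborel_pos. h t * of_real (k e t)) \<longlongrightarrow> L) (at_right 0)"
proof -
  have "\<forall>\<^sub>F t in at x. norm ((h t - h x) / of_real (t - x)) < norm D + 1"
    by (rule order_tendstoD[OF tendsto_norm[OF diff]]) simp
  then obtain r where r: "r > 0"
    "\<And>t. t \<noteq> x \<Longrightarrow> dist t x < r \<Longrightarrow> norm ((h t - h x) / of_real (t - x)) < norm D + 1"
    unfolding eventually_at by auto
  \<comment> \<open>Half of the minimum keeps the symmetric interval \<open>A\<close> inside the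
    region where the difference quotient is bounded and inside the positive half-line.\<close>
  define d where "d = min r x / 2"
  have d: "d > 0" "d < r" "d < x"
    using r(1) assms(1) by (auto simp: d_def)
  define A where "A = {x - d..x + d}"
  have A: "A \<subseteq> {0<..}" using d by (auto simp: A_def emeasure_lborel_Icc_eq)
  have [measurable]: "A \<in> sets borel" by (simp add: A_def)
  \<comment> \<open>Near \<open>x\<close> this is the difference quotient, away from
    \<open>x\<close> it is \<open>h t / (t - x)\<close>; at \<open>t = x\<close> division by zero
    makes it \<open>0\<close>.\<close>
  define g where "g = (\<lambda>t. (h t - indicator A t * h x) / of_real (t - x))"
  have id: "(\<lambda>t. t) \<in> borel_measurable lborel_pos"
    by (intro borel_measurable_lborel_pos continuous_intros)
  have indc: "(\<lambda>t. indicator A t :: complex) \<in> borel_measurable lborel_pos"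
    by (rule measurable_compose[OF id borel_measurable_indicator]) simp
  have gm: "g \<in> borel_measurable lborel_pos"
    unfolding g_def using meas id indc by measurable
  have intA: "integrable lborel (\<lambda>t. indicator A t *\<^sub>R k t)"
    if "k \<in> borel_measurable borel" "bounded (range k)" for k :: "real \<Rightarrow> complex"
  proof -
    from that(2) obtain B where "\<And>t. norm (k t) \<le> B"
      unfolding bounded_iff by auto
    then show ?thesis
      using that(1) by (intro integrableI_bounded_set_indicator[of A lborel k B]) (auto simp: A_def emeasure_lborel_Icc_eq)
  qed
  have pos_lborel: "{(0::real)<..} \<inter> space lborel \<in> sets lborel"
    by simp
  have restr: "indicator {0<..} t *\<^sub>R (indicator A t *\<^sub>R k) = (indicator A t *\<^sub>R k :: complex)" for t k
    using A by (cases "t \<in> A") auto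
  have gi: "integrable lborel_pos g"
  proof (rule Bochner_Integration.integrable_bound)
    \<comment> \<open>Outside \<open>A\<close> one has \<open>1 + t \<le> (1 + x) + |t - x|\<close>
      and \<open>|t - x| \<ge> d\<close>, whence \<open>1 + t \<le> ?C * |t - x|\<close>.\<close>
    let ?C = "(1 + x) / d + 1"
    have "integrable lborel_pos (\<lambda>t. indicator A t *\<^sub>R (1::complex))"
    proof -
      have "integrable lborel (\<lambda>t. indicator A t *\<^sub>R (1::complex))"
        by (rule intA) auto
      then show ?thesis by (simp only: integrable_restrict_space pos_lborel restr)
    qed
    then have "integrable lborel_pos (\<lambda>t. norm (indicator A t *\<^sub>R (1::complex)))"
      by (rule integrable_norm)
    with integrable_norm[OF int]
    show "integrable lborel_pos
        (\<lambda>t. (norm D + 1) * norm (indicator A t *\<^sub>R (1::complex)) + ?C * norm (h t / of_real (1 + t)))"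
      by (intro Bochner_Integration.integrable_add integrable_mult_right)
    show "AE t in lborel_pos. norm (g t) \<le>
        norm ((norm D + 1) * norm (indicator A t *\<^sub>R (1::complex)) + ?C * norm (h t / of_real (1 + t)))"
    proof (rule AE_I2)
      fix t assume "t \<in> space lborel_pos"
      then have t: "t > 0" by simp
      have "norm (g t) \<le> (norm D + 1) * norm (indicator A t *\<^sub>R (1::complex)) + ?C * norm (h t / of_real (1 + t))"
      proof (cases "t \<in> A")
        case True
        have "norm (g t) \<le> norm D + 1"
        proof (cases "t = x")
          case False
          moreover have "dist t x < r"
            using True d by (auto simp: A_def dist_real_def)
          ultimately have "norm ((h t - h x) / of_real (t - x)) < norm D + 1"
            by (rule r(2))
          with True show ?thesis
            by (simp add: g_def)
        qed (simp add: g_def)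
        moreover have "?C * norm (h t / of_real (1 + t)) \<ge> 0"
          using d assms(1) by simp
        ultimately show ?thesis using True by simp
      next
        case False
        then have "\<bar>t - x\<bar> \<ge> d" by (auto simp: A_def emeasure_lborel_Icc_eq)
        then have "(1 + x) * d \<le> (1 + x) * \<bar>t - x\<bar>"
          using assms(1) by (intro mult_left_mono) auto
        then have "1 + x \<le> (1 + x) / d * \<bar>t - x\<bar>"
          using d by (simp add: field_simps)
        then have "1 + t \<le> ?C * \<bar>t - x\<bar>"
          by (simp add: algebra_simps)
        moreover have "\<bar>t - x\<bar> > 0" using False d by (auto simp: A_def emeasure_lborel_Icc_eq)
        ultimately have "1 / \<bar>t - x\<bar> \<le> ?C / (1 + t)"
          using t by (simp add: field_simps)
        then have "norm (h t) * (1 / \<bar>t - x\<bar>) \<le> norm (h t) * (?C / (1 + t))"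
          by (intro mult_left_mono) auto
        moreover have "norm (g t) = norm (h t) * (1 / \<bar>t - x\<bar>)"
          using False by (simp add: g_def norm_divide flip: of_real_diff)
        moreover have "norm (h t / of_real (1 + t)) = norm (h t) / (1 + t)"
          using t by (simp add: norm_divide del: of_real_add)
        ultimately show ?thesis
          using False by (simp add: mult_ac)
      qed
      also have "\<dots> \<le> norm \<dots>"
        by (simp only: real_norm_def abs_ge_self)
      finally show "norm (g t) \<le>
        norm ((norm D + 1) * norm (indicator A t *\<^sub>R (1::complex)) + ?C * norm (h t / of_real (1 + t)))" .
    qed
  qed (rule gm)
  have split: "integrable lborel_pos (\<lambda>t. g t * of_real (k t * (t - x)))"
      "integrable lborel_pos (\<lambda>t. h t * of_real (k t))"
      "(LINT t|lborel_pos. h t * of_real (k t)) = (LINT t|lborel_pos. g t * of_real (k t * (t - x)))"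
    if "odd_kernel x k" for k :: "real \<Rightarrow> real"
  proof -
    from that have k: "k \<in> borel_measurable borel" "bounded (range k)"
      "\<And>t. k (2 * x - t) = - k t" "\<And>t. \<bar>k t * (t - x)\<bar> \<le> 1"
      by (auto simp: odd_kernel_def)
    have km: "k \<in> borel_measurable lborel_pos"
      using measurable_compose[OF id k(1)] by simp
    show 1: "integrable lborel_pos (\<lambda>t. g t * of_real (k t * (t - x)))"
    proof (rule Bochner_Integration.integrable_bound[OF gi])
      show "(\<lambda>t. g t * of_real (k t * (t - x))) \<in> borel_measurable lborel_pos"
        using gm km id by measurable
      show "AE t in lborel_pos. norm (g t * of_real (k t * (t - x))) \<le> norm (g t)"
      proof (rule AE_I2)
        fix t
        show "norm (g t * of_real (k t * (t - x))) \<le> norm (g t)"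
          unfolding norm_mult norm_of_real using mult_left_mono[OF k(4) norm_ge_zero[of "g t"]] by simp
      qed
    qed
    let ?kc = "\<lambda>t. of_real (k t) :: complex"
    have kc: "?kc \<in> borel_measurable borel" "bounded (range ?kc)"
      using k(1,2) by (auto simp: bounded_iff)
    note iA = intA[OF kc]
    have 2: "integrable lborel_pos (\<lambda>t. indicator A t *\<^sub>R ?kc t)"
      using iA by (simp only: integrable_restrict_space pos_lborel restr)
    \<comment> \<open>The reflection \<open>t -> 2 * x - t\<close> maps \<open>A\<close> to itself
      and reverses the sign of the kernel, so this integral equals its own negative.\<close>
    have "(LINT t|lborel. indicator A t *\<^sub>R ?kc t)
        = \<bar>- 1\<bar> *\<^sub>R (LINT t|lborel. indicator A (2 * x + - 1 * t) *\<^sub>R ?kc (2 * x + - 1 * t))"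
      by (rule lborel_integral_real_affine) simp
    also have "(\<lambda>t. indicator A (2 * x + - 1 * t) *\<^sub>R ?kc (2 * x + - 1 * t))
        = (\<lambda>t. - (indicator A t *\<^sub>R ?kc t))"
    proof
      fix t
      have "2 * x + - 1 * t \<in> A \<longleftrightarrow> t \<in> A" by (auto simp: A_def)
      moreover have "k (2 * x + - 1 * t) = - k t" using k(3)[of t] by simp
      ultimately show "indicator A (2 * x + - 1 * t) *\<^sub>R ?kc (2 * x + - 1 * t)
          = - (indicator A t *\<^sub>R ?kc t)"
        by (simp only: indicator_def of_real_minus scaleR_minus_right)
    qed
    finally have "(LINT t|lborel. indicator A t *\<^sub>R ?kc t) = 0"
      by simp
    then have 3: "(LINT t|lborel_pos. indicator A t *\<^sub>R ?kc t) = 0"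
      by (simp only: integral_restrict_space pos_lborel restr)
    have eq: "h t * ?kc t = g t * of_real (k t * (t - x)) + h x * (indicator A t *\<^sub>R ?kc t)" for t
    proof (cases "t = x")
      case True
      then show ?thesis using d by (simp add: A_def)
    next
      case False
      then have "complex_of_real t - of_real x \<noteq> 0" by simp
      then show ?thesis
        by (simp add: g_def field_simps scaleR_conv_of_real indicator_def)
    qed
    show "integrable lborel_pos (\<lambda>t. h t * of_real (k t))"
      unfolding eq using 1 2 by (intro Bochner_Integration.integrable_add integrable_mult_right)
    show "(LINT t|lborel_pos. h t * of_real (k t)) = (LINT t|lborel_pos. g t * of_real (k t * (t - x)))"
      unfolding eq
      by (simp only: Bochner_Integration.integral_add[OF 1 integrable_mult_right[OF 2]]
            integral_mult_right_zero 3 mult_zero_right add_0_right)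
  qed
  show ?thesis
  \<comment> \<open>The limit is the integral of \<open>g\<close>, in which no kernel occurs:
    \<open>k e t * (t - x)\<close> is at most \<open>1\<close> in modulus and tends to
    \<open>1\<close> off \<open>x\<close>.\<close>
  proof (rule that[of "LINT t|lborel_pos. g t"]; intro allI impI; (elim conjE)?)
    fix k :: "real \<Rightarrow> real \<Rightarrow> real"
    assume k: "\<forall>e>0. odd_kernel x (k e)"
      and lim: "\<forall>t. t \<noteq> x \<longrightarrow> ((\<lambda>e. k e t) \<longlongrightarrow> 1 / (t - x)) (at_right 0)"
    have "((\<lambda>e. LINT t|lborel_pos. g t * of_real (k e t * (t - x))) \<longlongrightarrow> (LINT t|lborel_pos. g t))
        (at_right 0)"
    proof (rule tendsto_integral_dominated[OF _ gm integrable_norm[OF gi]])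
      show "\<forall>\<^sub>F e in at_right 0. (\<lambda>t. g t * of_real (k e t * (t - x))) \<in> borel_measurable lborel_pos"
        using eventually_at_right_less
        by eventually_elim (rule borel_measurable_integrable, rule split(1), use k in auto)
      show "\<forall>\<^sub>F e in at_right 0. \<forall>t\<in>space lborel_pos. norm (g t * of_real (k e t * (t - x))) \<le> norm (g t)"
        using eventually_at_right_less
      proof eventually_elim
        case (elim e)
        have "norm (g t) * \<bar>k e t * (t - x)\<bar> \<le> norm (g t)" for t
          using k elim by (intro mult_left_le) (auto simp: odd_kernel_def)
        then show ?case
          by (simp add: norm_mult norm_of_real del: of_real_mult of_real_diff)
      qed
      fix t
      show "((\<lambda>e. g t * of_real (k e t * (t - x))) \<longlongrightarrow> g t) (at_right 0)"
      proof (cases "t = x")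
        case True
        then show ?thesis by (simp add: g_def)
      next
        case False
        have "((\<lambda>e. g t * of_real (k e t * (t - x))) \<longlongrightarrow> g t * of_real (1 / (t - x) * (t - x))) (at_right 0)"
          by (intro tendsto_intros lim[rule_format] False)
        with False show ?thesis by simp
      qed
    qed
    moreover have "\<forall>\<^sub>F e in at_right 0. (LINT t|lborel_pos. g t * of_real (k e t * (t - x)))
        = (LINT t|lborel_pos. h t * of_real (k e t))"
      using eventually_at_right_less
      by eventually_elim (rule split(3)[symmetric], use k in auto)
    ultimately show "((\<lambda>e. LINT t|lborel_pos. h t * of_real (k e t)) \<longlongrightarrow> (LINT t|lborel_pos. g t)) (at_right 0)"
      by (rule Lim_transform_eventually)
  qed (use split(2) in auto)
qed

text \<open>Plemelj's formula for the mean of the values just above and just below the cut, in which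
  the point contributions at \<open>x\<close> cancel. The kernels \<open>k1\<close> (truncation) and
  \<open>k2\<close> (mean of the two Cauchy kernels) are odd on the whole line, so truncations with
  \<open>e > x\<close> need no separate case.\<close>

lemma has_pv_integral_Cauchy:
  fixes h :: "real \<Rightarrow> complex"
  defines "S \<equiv> \<lambda>w. LINT t|lborel_pos. h t / (of_real t + w)"
  assumes "x > 0"
    and meas: "h \<in> borel_measurable lborel_pos"
    and int: "integrable lborel_pos (\<lambda>t. h t / of_real (1 + t))"
    and ints: "\<And>e. e \<noteq> 0 \<Longrightarrow> integrable lborel_pos (\<lambda>t. h t / (of_real t + Complex (- x) e))"
    and diff: "((\<lambda>t. (h t - h x) / of_real (t - x)) \<longlongrightarrow> D) (at x)"
    and lim: "((\<lambda>e. (S (Complex (- x) e) + S (Complex (- x) (- e))) / 2) \<longlongrightarrow> I) (at_right 0)"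
  shows "has_pv_integral (\<lambda>t. h t / of_real (t - x)) {0<..} x I"
proof -
  obtain L where L:
    "\<forall>k. odd_kernel x k \<longrightarrow> integrable lborel_pos (\<lambda>t. h t * of_real (k t))"
    "\<forall>k. (\<forall>e>0. odd_kernel x (k e)) \<and>
         (\<forall>t. t \<noteq> x \<longrightarrow> ((\<lambda>e. k e t) \<longlongrightarrow> 1 / (t - x)) (at_right (0::real))) \<longrightarrow>
      ((\<lambda>e. LINT t|lborel_pos. h t * of_real (k e t)) \<longlongrightarrow> L) (at_right 0)"
    by (rule odd_kernel_integral[OF assms(2) meas int diff])
  define k1 where "k1 = (\<lambda>e t. indicator (- {x - e..x + e}) t / (t - x))"
  define k2 where "k2 = (\<lambda>e t. (t - x) / ((t - x)\<^sup>2 + e\<^sup>2))"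
  have k1: "odd_kernel x (k1 e)" if e: "e > 0" for e
    unfolding odd_kernel_def
  proof (intro conjI allI)
    show "k1 e \<in> borel_measurable borel" unfolding k1_def by measurable
    show "bounded (range (k1 e))"
      unfolding bounded_iff
    proof (intro exI ballI)
      fix y assume "y \<in> range (k1 e)"
      then show "norm y \<le> 1 / e"
        using e by (auto simp: k1_def indicator_def field_simps)
    qed
    show "k1 e (2 * x - t) = - k1 e t" for t
      by (auto simp: k1_def indicator_def minus_divide_right)
    show "\<bar>k1 e t * (t - x)\<bar> \<le> 1" for t
      by (auto simp: k1_def indicator_def)
  qed
  have k2: "odd_kernel x (k2 e)" if e: "e > 0" for e
    unfolding odd_kernel_def
  proof (intro conjI allI)
    show "k2 e \<in> borel_measurable borel" unfolding k2_def by measurable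
    have pos: "y\<^sup>2 + e\<^sup>2 > 0" for y :: real using e by (simp add: add_nonneg_pos)
    show "bounded (range (k2 e))"
      unfolding bounded_iff
    proof (intro exI ballI)
      have "\<bar>y\<bar> / (y\<^sup>2 + e\<^sup>2) \<le> 1 / e" for y :: real
      proof -
        have "\<bar>y\<bar> * e \<le> y\<^sup>2 + e\<^sup>2"
        proof -
          have "\<bar>y\<bar> * e \<ge> 0" using e by simp
          moreover have "2 * \<bar>y\<bar> * e \<le> y\<^sup>2 + e\<^sup>2"
            using sum_squares_bound[of "\<bar>y\<bar>" e] by simp
          ultimately show ?thesis by linarith
        qed
        then show ?thesis using e pos[of y] by (simp add: divide_simps)
      qed
      then show "norm y \<le> 1 / e" if "y \<in> range (k2 e)" for y
        using that pos by (auto simp: k2_def less_imp_le)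
    qed
    show "k2 e (2 * x - t) = - k2 e t" for t
    proof -
      have "2 * x - t - x = - (t - x)" by simp
      then show ?thesis unfolding k2_def by (simp only: power2_minus minus_divide_left)
    qed
    show "\<bar>k2 e t * (t - x)\<bar> \<le> 1" for t
    proof -
      have "k2 e t * (t - x) = (t - x)\<^sup>2 / ((t - x)\<^sup>2 + e\<^sup>2)"
        by (simp add: k2_def power2_eq_square)
      then show ?thesis using pos[of "t - x"] by simp
    qed
  qed
  have ind: "indicator ({0<..} - {x - e..x + e}) t *\<^sub>R (h t / of_real (t - x))
      = indicator {0<..} t *\<^sub>R (h t * of_real (k1 e t))" for e t
    by (auto simp: k1_def indicator_def)
  have set_int: "set_integrable lborel ({0<..} - {x - e..x + e}) (\<lambda>t. h t / of_real (t - x))" if "e > 0" for e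
  proof -
    have "integrable lborel_pos (\<lambda>t. h t * of_real (k1 e t))"
      using k1[OF that] L(1) by blast
    then show ?thesis
      unfolding set_integrable_def ind by (simp add: integrable_restrict_space)
  qed
  have "((\<lambda>e. LINT t|lborel_pos. h t * of_real (k1 e t)) \<longlongrightarrow> L) (at_right 0)"
  proof (rule L(2)[rule_format], intro conjI allI impI k1)
    fix t assume "t \<noteq> x"
    then have "\<forall>\<^sub>F e in at_right 0. e < \<bar>t - x\<bar>"
      by (intro eventually_at_right_real[THEN eventually_mono]) auto
    then have "\<forall>\<^sub>F e in at_right 0. 1 / (t - x) = k1 e t"
      by eventually_elim (auto simp: k1_def indicator_def)
    then show "((\<lambda>e. k1 e t) \<longlongrightarrow> 1 / (t - x)) (at_right 0)"
      by (rule Lim_transform_eventually[OF tendsto_const])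
  qed
  then have lim1: "((\<lambda>e. LINT t:({0<..} - {x - e..x + e})|lborel. h t / of_real (t - x)) \<longlongrightarrow> L) (at_right 0)"
    unfolding set_lebesgue_integral_def ind by (simp add: integral_restrict_space)
  have "((\<lambda>e. LINT t|lborel_pos. h t * of_real (k2 e t)) \<longlongrightarrow> L) (at_right 0)"
  proof (rule L(2)[rule_format], intro conjI allI impI k2)
    fix t assume "t \<noteq> x"
    then have "((\<lambda>e. k2 e t) \<longlongrightarrow> (t - x) / ((t - x)\<^sup>2 + 0\<^sup>2)) (at_right 0)"
      unfolding k2_def by (intro tendsto_intros) auto
    with \<open>t \<noteq> x\<close> show "((\<lambda>e. k2 e t) \<longlongrightarrow> 1 / (t - x)) (at_right 0)"
      by (simp add: power2_eq_square)
  qed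
  moreover have "(LINT t|lborel_pos. h t * of_real (k2 e t))
      = (S (Complex (- x) e) + S (Complex (- x) (- e))) / 2" if "e > 0" for e
  proof -
    have "h t * of_real (k2 e t)
        = (h t / (of_real t + Complex (- x) e) + h t / (of_real t + Complex (- x) (- e))) / 2" for t
    proof -
      let ?u = "of_real t + Complex (- x) e" and ?v = "of_real t + Complex (- x) (- e)"
      have nz: "?u \<noteq> 0" "?v \<noteq> 0" using that by (auto simp: complex_eq_iff)
      have "?u * ?v = of_real ((t - x)\<^sup>2 + e\<^sup>2)" "?u + ?v = of_real (2 * (t - x))"
        by (simp_all add: complex_eq_iff power2_eq_square algebra_simps)
      moreover have "(h t / ?u + h t / ?v) / 2 = h t * ((?u + ?v) / (?u * ?v) / 2)"
        using nz by (simp add: field_simps)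
      moreover have "of_real (2 * y) / of_real Q / 2 = (of_real (y / Q) :: complex)" for y Q
        by simp
      ultimately show ?thesis
        by (simp only: k2_def)
    qed
    moreover have "integrable lborel_pos (\<lambda>t. h t / (of_real t + Complex (- x) e))"
      "integrable lborel_pos (\<lambda>t. h t / (of_real t + Complex (- x) (- e)))"
      using that by (auto intro!: ints)
    ultimately show ?thesis
      unfolding S_def
      by (simp only: integral_divide_zero Bochner_Integration.integral_add)
  qed
  ultimately have "((\<lambda>e. (S (Complex (- x) e) + S (Complex (- x) (- e))) / 2) \<longlongrightarrow> L) (at_right 0)"
    by (elim Lim_transform_eventually) (auto intro: eventually_mono[OF eventually_at_right_less])
  with lim have "I = L"
    by (intro tendsto_unique[OF trivial_limit_at_right_real])
  with set_int lim1 show ?thesis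
    by (simp add: has_pv_integral_def)
qed

section \<open>Stieltjes transforms of functions bounded by a multiple of
  \<open>t powr (- 1 / 2)\<close>\<close>

lemma integrable_inverse_sqrt_over:
  "integrable lborel_pos (\<lambda>t. t powr (- 1 / 2) / (1 + t))"
proof -
  have "set_integrable lborel (einterval 0 \<infinity>) (\<lambda>t. t powr (- 1 / 2) / (1 + t))"
  proof (rule interval_integral_FTC_nonneg(1))
    fix t :: real assume "0 < ereal t"
    then have t: "t > 0" by simp
    \<comment> \<open>An explicit antiderivative with the finite limits \<open>0\<close> and
      \<open>pi\<close> at the two ends yields integrability of the nonnegative integrand.\<close>
    then have "((\<lambda>t. 2 * arctan (sqrt t)) has_real_derivative
        2 * (inverse (1 + (sqrt t)\<^sup>2) * (inverse (sqrt t) / 2))) (at t)"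
      by (auto intro!: derivative_eq_intros)
    also have "2 * (inverse (1 + (sqrt t)\<^sup>2) * (inverse (sqrt t) / 2)) = t powr (- 1 / 2) / (1 + t)"
    proof -
      have eq: "t powr (- 1 / 2) = inverse (sqrt t)"
        using t powr_minus[of t "1 / 2"] by (simp add: powr_half_sqrt)
      show ?thesis unfolding eq using t by (simp add: inverse_eq_divide)
    qed
    finally show "((\<lambda>t. 2 * arctan (sqrt t)) has_real_derivative t powr (- 1 / 2) / (1 + t)) (at t)" .
    show "isCont (\<lambda>t. t powr (- 1 / 2) / (1 + t)) t"
      using t by (intro continuous_intros) auto
  next
    have "((\<lambda>t. 2 * arctan (sqrt t)) \<longlongrightarrow> 0) (at_right 0)"
      by (auto intro!: tendsto_eq_intros)
    then show "(((\<lambda>t. 2 * arctan (sqrt t)) \<circ> real_of_ereal) \<longlongrightarrow> 0) (at_right 0)"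
      by (simp add: ereal_tendsto_simps zero_ereal_def)
    have "((\<lambda>t. 2 * arctan (sqrt t)) \<longlongrightarrow> 2 * (pi / 2)) at_top"
      by (intro tendsto_intros filterlim_compose[OF tendsto_arctan_at_top] sqrt_at_top)
    then show "(((\<lambda>t. 2 * arctan (sqrt t)) \<circ> real_of_ereal) \<longlongrightarrow> 2 * (pi / 2)) (at_left \<infinity>)"
      by (simp add: ereal_tendsto_simps)
  qed auto
  then show ?thesis
    by (simp add: set_integrable_def integrable_restrict_space einterval_eq zero_ereal_def)
qed

text \<open>\<open>(t + z) / (1 + t)\<close> is a convex combination of \<open>z\<close> and
  \<open>1\<close>. The segment joining these misses \<open>0\<close> because \<open>z\<close> is
  off the nonpositive axis, and a closed set missing \<open>0\<close> has positive distance from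
  it.\<close>

lemma norm_add_slit_plane_ge:
  fixes z :: complex
  assumes "z \<notin> \<real>\<^sub>\<le>\<^sub>0"
  obtains \<kappa> where "\<kappa> > 0" "\<And>t::real. t \<ge> 0 \<Longrightarrow> norm (of_real t + z) \<ge> \<kappa> * (1 + t)"
proof -
  have "0 \<notin> closed_segment z 1"
  proof
    assume "0 \<in> closed_segment z 1"
    then obtain u where u: "0 \<le> u" "u \<le> 1" "0 = (1 - u) *\<^sub>R z + u *\<^sub>R 1"
      unfolding in_segment by auto
    then have "u \<noteq> 1" by auto
    with u have "z = of_real (- u / (1 - u))"
      by (simp add: complex_eq_iff field_simps)
    moreover have "- u / (1 - u) \<le> 0"
      using u by (simp add: divide_nonpos_nonneg)
    ultimately have "z \<in> \<real>\<^sub>\<le>\<^sub>0"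
      by (simp only: complex_nonpos_Reals_iff Re_complex_of_real Im_complex_of_real simp_thms)
    with assms show False by contradiction
  qed
  then obtain \<kappa> where \<kappa>: "\<kappa> > 0" "ball 0 \<kappa> \<subseteq> - closed_segment z 1"
    using open_contains_ball[of "- closed_segment z 1"] by (auto simp: open_Compl closed_nonpos_Reals_complex)
  have "norm (of_real t + z) \<ge> \<kappa> * (1 + t)" if t: "t \<ge> 0" for t :: real
  proof -
    have eq: "1 - t / (1 + t) = 1 / (1 + t)" using t by (simp add: field_simps)
    have "(of_real t + z) /\<^sub>R (1 + t) = (1 - t / (1 + t)) *\<^sub>R z + (t / (1 + t)) *\<^sub>R 1"
      unfolding eq by (simp add: scaleR_conv_of_real divide_inverse algebra_simps)
    moreover have "0 \<le> t / (1 + t)" "t / (1 + t) \<le> 1" using t by auto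
    ultimately have "(of_real t + z) /\<^sub>R (1 + t) \<in> closed_segment z 1"
      unfolding in_segment by blast
    with \<kappa>(2) have "(of_real t + z) /\<^sub>R (1 + t) \<notin> ball 0 \<kappa>" by blast
    then have "norm (of_real t + z) / (1 + t) \<ge> \<kappa>"
      using t by (simp add: divide_inverse mult.commute)
    then show ?thesis using t by (simp add: field_simps)
  qed
  with \<kappa>(1) show ?thesis by (rule that)
qed

lemma integrable_stieltjes:
  fixes h :: "real \<Rightarrow> complex"
  assumes h: "h \<in> borel_measurable lborel_pos"
    and le: "\<And>t. t > 0 \<Longrightarrow> norm (h t) \<le> C * t powr (- 1 / 2)"
    and z: "z \<notin> \<real>\<^sub>\<le>\<^sub>0"
  shows "integrable lborel_pos (\<lambda>t. h t / (of_real t + z))"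
proof -
  obtain \<kappa> where \<kappa>: "\<kappa> > 0" "\<And>t::real. t \<ge> 0 \<Longrightarrow> norm (of_real t + z) \<ge> \<kappa> * (1 + t)"
    using norm_add_slit_plane_ge[OF z] by blast
  have id: "(\<lambda>t. t) \<in> borel_measurable lborel_pos"
    by (intro borel_measurable_lborel_pos continuous_intros)
  show ?thesis
  proof (rule Bochner_Integration.integrable_bound)
    show "integrable lborel_pos (\<lambda>t. C / \<kappa> * (t powr (- 1 / 2) / (1 + t)))"
      by (intro integrable_mult_right integrable_inverse_sqrt_over)
    show "(\<lambda>t. h t / (of_real t + z)) \<in> borel_measurable lborel_pos"
      using h id by measurable
    show "AE t in lborel_pos. norm (h t / (of_real t + z))
        \<le> norm (C / \<kappa> * (t powr (- 1 / 2) / (1 + t)))"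
    proof (rule AE_I2)
      fix t assume "t \<in> space lborel_pos"
      then have t: "t > 0" by simp
      have pos: "\<kappa> * (1 + t) > 0" using t \<kappa>(1) by simp
      have "norm (h t / (of_real t + z)) \<le> C * t powr (- 1 / 2) / (\<kappa> * (1 + t))"
        unfolding norm_divide
        using le[OF t] \<kappa>(2)[of t] t pos by (intro frac_le) (auto intro: order_trans[OF norm_ge_zero])
      also have "\<dots> = C / \<kappa> * (t powr (- 1 / 2) / (1 + t))"
        by simp
      also have "\<dots> \<le> norm \<dots>"
        by (simp only: real_norm_def abs_ge_self)
      finally show "norm (h t / (of_real t + z)) \<le> norm (C / \<kappa> * (t powr (- 1 / 2) / (1 + t)))" .
    qed
  qed
qed

lemma holomorphic_on_stieltjes:
  fixes h :: "real \<Rightarrow> complex"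
  assumes h: "h \<in> borel_measurable lborel_pos"
    and le: "\<And>t. t > 0 \<Longrightarrow> norm (h t) \<le> C * t powr (- 1 / 2)"
  shows "(\<lambda>z. LINT t|lborel_pos. h t / (of_real t + z)) holomorphic_on - \<real>\<^sub>\<le>\<^sub>0"
  unfolding holomorphic_on_open[OF open_Compl[OF closed_nonpos_Reals_complex]]
proof (intro ballI exI)
  fix z0 :: complex assume "z0 \<in> - \<real>\<^sub>\<le>\<^sub>0"
  then have z0: "z0 \<notin> \<real>\<^sub>\<le>\<^sub>0" by simp
  obtain \<kappa> where \<kappa>: "\<kappa> > 0" "\<And>t::real. t \<ge> 0 \<Longrightarrow> norm (of_real t + z0) \<ge> \<kappa> * (1 + t)"
    using norm_add_slit_plane_ge[OF z0] by blast
  obtain r where r: "r > 0" "ball z0 r \<subseteq> - \<real>\<^sub>\<le>\<^sub>0"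
    using z0 open_contains_ball[of "- \<real>\<^sub>\<le>\<^sub>0 :: complex set"]
    by (auto simp: open_Compl closed_nonpos_Reals_complex)
  \<comment> \<open>\<open>r\<close> keeps the ball in the slit plane; a shift by at most
    \<open>\<kappa> / 2\<close> costs at most half of the lower bound, uniformly in
    \<open>t\<close>.\<close>
  define \<rho> where "\<rho> = min r (\<kappa> / 2)"
  have id: "(\<lambda>t. t) \<in> borel_measurable lborel_pos"
    by (intro borel_measurable_lborel_pos continuous_intros)
  have lower: "\<kappa> / 2 * (1 + t) \<le> norm (of_real t + z)" if "z \<in> ball z0 \<rho>" "t > 0" for z t
  proof -
    have "norm (of_real t + z0) \<le> norm (of_real t + z) + norm (z0 - z)"
      using norm_triangle_ineq[of "of_real t + z" "z0 - z"] by simp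
    moreover have "norm (z0 - z) \<le> \<kappa> / 2"
      using that by (simp add: \<rho>_def dist_norm)
    moreover have "\<kappa> / 2 \<le> \<kappa> / 2 * (1 + t)"
      using that \<kappa>(1) by simp
    moreover have "\<kappa> * (1 + t) \<le> norm (of_real t + z0)"
      using \<kappa>(2)[of t] that by simp
    ultimately show ?thesis by (simp add: algebra_simps)
  qed
  show "((\<lambda>z. LINT t|lborel_pos. h t / (of_real t + z)) has_field_derivative
      (LINT t|lborel_pos. - (h t / (of_real t + z0)\<^sup>2))) (at z0)"
  proof (rule has_field_derivative_integral_dominated[where r = \<rho>])
    show "\<rho> > 0" using r \<kappa> by (simp add: \<rho>_def)
    show "integrable lborel_pos (\<lambda>t. C / (\<kappa> / 2)\<^sup>2 * (t powr (- 1 / 2) / (1 + t)))"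
      by (intro integrable_mult_right integrable_inverse_sqrt_over)
    show "(\<lambda>t. - (h t / (of_real t + z0)\<^sup>2)) \<in> borel_measurable lborel_pos"
      using h id by measurable
    fix z assume z: "z \<in> ball z0 \<rho>"
    then have "z \<notin> \<real>\<^sub>\<le>\<^sub>0" using r by (auto simp: \<rho>_def)
    then show "integrable lborel_pos (\<lambda>t. h t / (of_real t + z))"
      by (intro integrable_stieltjes[OF h le])
    fix t assume "t \<in> space lborel_pos"
    then have t: "t > 0" by simp
    from lower[OF z t] have pos: "norm (of_real t + z) \<ge> \<kappa> / 2 * (1 + t)" "\<kappa> / 2 * (1 + t) > 0"
      using \<kappa> t by auto
    then have nz: "of_real t + z \<noteq> 0" by auto
    then show "((\<lambda>z. h t / (of_real t + z)) has_field_derivative - (h t / (of_real t + z)\<^sup>2)) (at z)"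
      by (auto intro!: derivative_eq_intros simp: power2_eq_square)
    have "norm (- (h t / (of_real t + z)\<^sup>2)) = norm (h t) / (norm (of_real t + z))\<^sup>2"
      by (simp only: norm_minus_cancel norm_divide norm_power)
    also have "\<dots> \<le> C * t powr (- 1 / 2) / (\<kappa> / 2 * (1 + t))\<^sup>2"
      using le[OF t] pos
      by (intro frac_le power_mono) (auto intro: order_trans[OF norm_ge_zero])
    \<comment> \<open>One of the two factors \<open>1 + t\<close> is dropped, so that the majorant
      of the transform serves for its derivative too.\<close>
    also have "\<dots> \<le> C * t powr (- 1 / 2) / ((\<kappa> / 2)\<^sup>2 * (1 + t))"
    proof (rule divide_left_mono)
      show "(\<kappa> / 2)\<^sup>2 * (1 + t) \<le> (\<kappa> / 2 * (1 + t))\<^sup>2"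
        unfolding power_mult_distrib using t
        by (intro mult_left_mono) (auto simp: power2_eq_square)
      show "0 \<le> C * t powr (- 1 / 2)"
        using le[OF t] by (rule order_trans[OF norm_ge_zero])
    qed (use \<kappa> t in auto)
    finally show "norm (- (h t / (of_real t + z)\<^sup>2)) \<le> C / (\<kappa> / 2)\<^sup>2 * (t powr (- 1 / 2) / (1 + t))"
      by simp
  qed
qed

section \<open>The Stieltjes transform of the Bessel function\<close>

lemma sigma_finite_lborel_pos: "sigma_finite_measure lborel_pos"
  by (rule sigma_finite_measure_restrict_space) (auto intro: sigma_finite_lborel)

definition bessel_wave :: "complex \<Rightarrow> real \<Rightarrow> real \<Rightarrow> complex" where
  "bessel_wave a b t = of_real t powr a * bessel_clifford a (- of_real (b * t))"

lemma continuous_on_bessel_wave: "continuous_on {0<..} (bessel_wave a b)"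
  unfolding bessel_wave_def
  by (intro continuous_intros) (auto simp: complex_nonpos_Reals_iff)

lemmas borel_measurable_bessel_wave = borel_measurable_lborel_pos[OF continuous_on_bessel_wave]

lemma norm_bessel_wave_le:
  assumes "Re a = - 1 / 2" "b \<ge> 0" "t > 0"
  shows "norm (bessel_wave a b t) \<le> norm (rGamma (a + 1)) * t powr (- 1 / 2)"
proof -
  have "norm (bessel_clifford a (- of_real (b * t))) \<le> norm (rGamma (a + 1))"
    using assms by (intro norm_bessel_clifford_neg_le) auto
  then have "t powr Re a * norm (bessel_clifford a (- of_real (b * t)))
      \<le> t powr Re a * norm (rGamma (a + 1))"
    by (intro mult_left_mono) auto
  then show ?thesis
    using assms(3) unfolding bessel_wave_def norm_mult assms(1)
    by (simp add: norm_powr_real_powr assms(1) mult.commute)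
qed

text \<open>Writing \<open>1 / (t + w)\<close> as the integral of
  \<open>exp (- (p * (t + w)))\<close> over \<open>p\<close> and exchanging the integrals leaves the
  Laplace transform inside; \<open>q = w * p\<close> then produces the kernel of
  \<open>K_integral\<close>. Fubini applies since integrating the modulus over \<open>p\<close>
  returns \<open>|h t| / (t + w)\<close>, which is integrable.\<close>

lemma stieltjes_bessel_wave_of_real:
  assumes a: "Re a = - 1 / 2" and b: "b > 0" and w: "w > 0"
  shows "(LINT t|lborel_pos. bessel_wave a b t / (of_real t + of_real w))
           = of_real w powr a * K_integral a (of_real (b * w))"
proof -
  interpret L: sigma_finite_measure lborel_pos by (rule sigma_finite_lborel_pos)
  interpret pair_sigma_finite lborel_pos lborel_pos ..
  let ?h = "bessel_wave a b"
  let ?e = "\<lambda>t p. exp (- (p * (t + w)))"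
  let ?F = "\<lambda>t p. ?h t * of_real (?e t p)"
  have id: "(\<lambda>t. t) \<in> borel_measurable lborel_pos"
    by (intro borel_measurable_lborel_pos continuous_intros)
  have fst: "(\<lambda>x. fst x) \<in> borel_measurable (lborel_pos \<Otimes>\<^sub>M lborel_pos)"
    and snd: "(\<lambda>x. snd x) \<in> borel_measurable (lborel_pos \<Otimes>\<^sub>M lborel_pos)"
    using measurable_compose[OF measurable_fst id] measurable_compose[OF measurable_snd id] by auto
  have hfst: "(\<lambda>x. ?h (fst x)) \<in> borel_measurable (lborel_pos \<Otimes>\<^sub>M lborel_pos)"
    by (rule measurable_compose[OF measurable_fst borel_measurable_bessel_wave])
  have p_int: "has_bochner_integral lborel_pos (?F t) (?h t / (of_real t + of_real w))"
    and p_norm: "has_bochner_integral lborel_pos (\<lambda>p. norm (?F t p)) (norm (?h t / (of_real t + of_real w)))"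
    if t: "t > 0" for t
  proof -
    have tw: "t + w > 0" using t w by simp
    have "has_bochner_integral lborel_pos (\<lambda>p. p powr (1 - 1) * exp (- ((t + w) * p))) (Gamma 1 * (t + w) powr - 1)"
      by (rule has_bochner_integral_Gamma_real) (use tw in auto)
    also have "?this \<longleftrightarrow> has_bochner_integral lborel_pos (\<lambda>p. ?e t p) (1 / (t + w))"
      by (rule has_bochner_integral_cong) (use tw in \<open>simp_all add: powr_minus_divide mult.commute\<close>)
    finally have e: "has_bochner_integral lborel_pos (\<lambda>p. ?e t p) (1 / (t + w))" .
    have "has_bochner_integral lborel_pos (\<lambda>p. complex_of_real (?e t p)) (of_real (1 / (t + w)))"
      by (rule has_bochner_integral_bounded_linear[OF bounded_linear_of_real e])
    from has_bochner_integral_mult_right[OF this, of "?h t"]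
    show "has_bochner_integral lborel_pos (?F t) (?h t / (of_real t + of_real w))"
      by simp
    have eq1: "norm (?F t p) = norm (?h t) * ?e t p" for p
      by (simp only: norm_mult norm_of_real abs_exp_cancel)
    have eq2: "norm (?h t / (of_real t + of_real w)) = norm (?h t) * (1 / (t + w))"
      using tw by (simp add: norm_divide flip: of_real_add)
    show "has_bochner_integral lborel_pos (\<lambda>p. norm (?F t p)) (norm (?h t / (of_real t + of_real w)))"
      unfolding eq1 eq2 by (rule has_bochner_integral_mult_right[OF e])
  qed
  have w': "of_real w \<notin> (\<real>\<^sub>\<le>\<^sub>0 :: complex set)"
    using w by (simp add: complex_nonpos_Reals_iff)
  have "integrable (lborel_pos \<Otimes>\<^sub>M lborel_pos) (case_prod ?F)"
  proof (rule Fubini_integrable)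
    show "case_prod ?F \<in> borel_measurable (lborel_pos \<Otimes>\<^sub>M lborel_pos)"
      unfolding case_prod_beta using hfst fst snd by measurable
    have "integrable lborel_pos (\<lambda>t. norm (?h t / (of_real t + of_real w)))"
      using a b w' by (intro integrable_norm integrable_stieltjes[OF borel_measurable_bessel_wave norm_bessel_wave_le]) auto
    also have "?this \<longleftrightarrow> integrable lborel_pos (\<lambda>t. LINT p|lborel_pos. norm (case (t, p) of (t, p) \<Rightarrow> ?F t p))"
      by (rule Bochner_Integration.integrable_cong[OF refl])
         (use p_norm in \<open>simp add: has_bochner_integral_iff\<close>)
    finally show "integrable lborel_pos (\<lambda>t. LINT p|lborel_pos. norm (case (t, p) of (t, p) \<Rightarrow> ?F t p))" .
    show "AE t in lborel_pos. integrable lborel_pos (\<lambda>p. case (t, p) of (t, p) \<Rightarrow> ?F t p)"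
      by (rule AE_I2) (use p_int in \<open>simp add: has_bochner_integral_iff\<close>)
  qed
  then have Fubini: "(LINT p|lborel_pos. LINT t|lborel_pos. ?F t p) = (LINT t|lborel_pos. LINT p|lborel_pos. ?F t p)"
    by (rule Fubini_integral)
  have "(LINT t|lborel_pos. ?h t / (of_real t + of_real w)) = (LINT t|lborel_pos. LINT p|lborel_pos. ?F t p)"
    by (rule Bochner_Integration.integral_cong[OF refl])
       (use p_int in \<open>simp add: has_bochner_integral_iff\<close>)
  also have "\<dots> = (LINT p|lborel_pos. LINT t|lborel_pos. ?F t p)"
    by (rule Fubini[symmetric])
  also have "\<dots> = (LINT p|lborel_pos. of_real w powr a * (of_real w * K_kernel a (of_real (b * w)) (w * p)))"
  proof (rule Bochner_Integration.integral_cong[OF refl])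
    fix p assume "p \<in> space lborel_pos"
    then have p: "p > 0" by simp
    have "has_bochner_integral lborel_pos (\<lambda>t. ?h t * of_real (exp (- (p * t))))
           (of_real p powr (- a - 1) * of_real (exp (- b / p)))"
      unfolding bessel_wave_def using a p by (intro laplace_transform_bessel_clifford) auto
    from has_bochner_integral_mult_left[OF this, of "of_real (exp (- (p * w)))"]
    have "(LINT t|lborel_pos. ?h t * of_real (exp (- (p * t))) * of_real (exp (- (p * w))))
        = of_real p powr (- a - 1) * of_real (exp (- b / p)) * of_real (exp (- (p * w)))"
      by (simp add: has_bochner_integral_iff)
    moreover have "?F t p = ?h t * of_real (exp (- (p * t))) * of_real (exp (- (p * w)))" for t
      by (simp add: exp_add [symmetric] distrib_left flip: of_real_mult)
    ultimately have "(LINT t|lborel_pos. ?F t p)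
        = of_real p powr (- a - 1) * (of_real (exp (- b / p)) * of_real (exp (- (p * w))))"
      by (simp only: mult.assoc)
    also have "of_real (exp (- b / p)) * of_real (exp (- (p * w)))
        = exp (- of_real (w * p) - of_real (b * w) / of_real (w * p) :: complex)"
    proof -
      have "- (w * p) - b * w / (w * p) = - b / p + - (p * w)"
        using w p by (simp add: field_simps)
      then have "exp (- of_real (w * p) - of_real (b * w) / of_real (w * p) :: complex)
          = of_real (exp (- b / p + - (p * w)))"
        by (metis exp_of_real of_real_diff of_real_divide of_real_minus)
      then show ?thesis by (simp only: exp_add of_real_mult)
    qed
    also have "of_real p powr (- a - 1) = of_real w powr a * (of_real w * of_real (w * p) powr (- a - 1))"
      using powr_times_real[of "of_real w" "of_real p" "- a - 1"] w p
      by (simp add: powr_diff powr_minus)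
    finally show "(LINT t|lborel_pos. ?F t p)
        = of_real w powr a * (of_real w * K_kernel a (of_real (b * w)) (w * p))"
      by (simp only: K_kernel_def mult.assoc)
  qed
  also have "\<dots> = of_real w powr a * K_integral a (of_real (b * w))"
  proof -
    have "has_bochner_integral lborel_pos (\<lambda>p. of_real w * K_kernel a (of_real (b * w)) (w * p))
        (K_integral a (of_real (b * w)))"
      unfolding K_integral_def using b w
      by (intro has_bochner_integral_lborel_pos_scale continuous_on_K_kernel
            has_bochner_integral_integrable integrable_K_kernel) auto
    then show ?thesis by (simp add: has_bochner_integral_iff)
  qed
  finally show ?thesis .
qed

lemma nonpos_Reals_complex_eq: "(\<real>\<^sub>\<le>\<^sub>0 :: complex set) = of_real ` {..0}"
  by (auto simp: nonpos_Reals_def)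

text \<open>On the positive axis \<open>w powr a * (b * w) powr (- a) = b powr (- a)\<close>, which
  brings the connection formula into a shape holomorphic on the slit plane. That plane is starlike,
  hence connected, and the identity theorem applies.\<close>

lemma stieltjes_bessel_wave:
  assumes a: "Re a = - 1 / 2" and b: "b > 0" and z: "z \<notin> \<real>\<^sub>\<le>\<^sub>0"
  shows "(LINT t|lborel_pos. bessel_wave a b t / (of_real t + z)) * (rGamma (a + 1) * rGamma (- a))
           = z powr a * bessel_clifford a (of_real b * z)
             - of_real b powr (- a) * bessel_clifford (- a) (of_real b * z)"
proof -
  let ?S = "\<lambda>z. LINT t|lborel_pos. bessel_wave a b t / (of_real t + z)"
  let ?D = "\<lambda>z. ?S z * (rGamma (a + 1) * rGamma (- a))
    - (z powr a * bessel_clifford a (of_real b * z)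
        - of_real b powr (- a) * bessel_clifford (- a) (of_real b * z))"
  have le: "norm (bessel_wave a b t) \<le> norm (rGamma (a + 1)) * t powr (- 1 / 2)" if "t > 0" for t
    using norm_bessel_wave_le[OF a _ that] b by simp
  have "?D z = 0"
  proof (rule analytic_continuation[where f = ?D and w = z and S = "- \<real>\<^sub>\<le>\<^sub>0" and U = "of_real ` {0<..}" and \<xi> = 1])
    show "?D holomorphic_on - \<real>\<^sub>\<le>\<^sub>0"
      by (intro holomorphic_intros holomorphic_on_stieltjes[OF borel_measurable_bessel_wave le]) auto
    show "connected (- \<real>\<^sub>\<le>\<^sub>0 :: complex set)"
      unfolding nonpos_Reals_complex_eq
      by (intro starlike_imp_connected starlike_slotted_complex_plane_left)
    show "1 islimpt (of_real ` {0<..} :: complex set)"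
      unfolding islimpt_approachable
    proof (intro allI impI)
      fix e :: real assume "e > 0"
      then have "of_real (1 + e / 2) \<in> (of_real ` {0<..} :: complex set)"
        by (intro imageI) simp
      moreover have "of_real (1 + e / 2) \<noteq> (1::complex)" "dist (of_real (1 + e / 2)) (1::complex) < e"
        using \<open>e > 0\<close> by (simp_all add: dist_norm)
      ultimately show "\<exists>x'\<in>of_real ` {0<..}. x' \<noteq> 1 \<and> dist x' (1::complex) < e"
        by blast
    qed
    show "?D w = 0" if "w \<in> of_real ` {0<..}" for w
    proof -
      from that obtain x where x: "w = of_real x" "x > 0" by auto
      have "?S w * (rGamma (a + 1) * rGamma (- a))
          = w powr a * (K_integral a (of_real (b * x)) * (rGamma (a + 1) * rGamma (- a)))"
        unfolding x(1) stieltjes_bessel_wave_of_real[OF a b x(2)] by (simp only: mult.assoc)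
      also have "\<dots> = w powr a * (bessel_clifford a (of_real b * w)
          - (of_real b * w) powr (- a) * bessel_clifford (- a) (of_real b * w))"
        using a b x by (subst K_integral_conv_bessel_clifford) auto
      also have "(of_real b * w) powr (- a) = of_real b powr (- a) * w powr (- a)"
        using b x by (intro powr_times_real) auto
      also have "w powr a * (bessel_clifford a (of_real b * w)
          - of_real b powr (- a) * w powr (- a) * bessel_clifford (- a) (of_real b * w))
        = w powr a * bessel_clifford a (of_real b * w)
          - of_real b powr (- a) * bessel_clifford (- a) (of_real b * w)"
        using x by (simp add: powr_minus field_simps)
      finally show ?thesis by simp
    qed
  qed (use z in \<open>auto simp: complex_nonpos_Reals_iff open_Compl\<close>)
  then show ?thesis by simp
qed

section \<open>Boundary values on the cut and the principal value\<close>

lemma tendsto_powr_cut: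
  fixes x :: real and a :: complex
  assumes x: "x > 0"
  shows "((\<lambda>e. Complex (- x) e powr a) \<longlongrightarrow> exp (\<i> * of_real pi * a) * of_real x powr a) (at_right 0)"
    and "((\<lambda>e. Complex (- x) (- e) powr a) \<longlongrightarrow> exp (- (\<i> * of_real pi * a)) * of_real x powr a) (at_right 0)"
proof -
  have x': "of_real x \<notin> (\<real>\<^sub>\<le>\<^sub>0 :: complex set)"
    using x by (simp add: complex_nonpos_Reals_iff)
  have "((\<lambda>e. Complex x (- e)) \<longlongrightarrow> of_real x) (at_right 0)"
    "((\<lambda>e. Complex x e) \<longlongrightarrow> of_real x) (at_right 0)"
    unfolding Complex_eq by (auto intro!: tendsto_eq_intros)
  then have "((\<lambda>e. Complex x (- e) powr a) \<longlongrightarrow> of_real x powr a) (at_right 0)"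
    "((\<lambda>e. Complex x e powr a) \<longlongrightarrow> of_real x powr a) (at_right 0)"
    by (auto intro: isCont_tendsto_compose[OF DERIV_isCont[OF has_field_derivative_powr[OF x']]])
  then have lim: "((\<lambda>e. exp (\<i> * of_real pi * a) * Complex x (- e) powr a)
        \<longlongrightarrow> exp (\<i> * of_real pi * a) * of_real x powr a) (at_right 0)"
    "((\<lambda>e. exp (- (\<i> * of_real pi * a)) * Complex x e powr a)
        \<longlongrightarrow> exp (- (\<i> * of_real pi * a)) * of_real x powr a) (at_right 0)"
    by - (rule tendsto_mult[OF tendsto_const], assumption)+
  \<comment> \<open>Negation takes the points to ones near \<open>x\<close>, off the cut, where
    continuity gave the limits; it shifts \<open>Ln\<close> by \<open>i pi\<close> above the cut and
    by \<open>- i pi\<close> below.\<close>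
  have eq: "exp (\<i> * of_real pi * a) * Complex x (- e) powr a = Complex (- x) e powr a"
    "exp (- (\<i> * of_real pi * a)) * Complex x e powr a = Complex (- x) (- e) powr a" if e: "e > 0" for e
  proof -
    have nz: "Complex x (- e) \<noteq> 0" "Complex x e \<noteq> 0" using e by (auto simp: complex_eq_iff)
    have m: "Complex (- x) e = - Complex x (- e)" "Complex (- x) (- e) = - Complex x e"
      by (simp_all add: complex_eq_iff)
    have Ln: "Ln (- Complex x (- e)) = Ln (Complex x (- e)) + \<i> * pi"
      "Ln (- Complex x e) = Ln (Complex x e) - \<i> * pi"
      using e x nz by (simp_all add: Ln_minus)
    show "exp (\<i> * of_real pi * a) * Complex x (- e) powr a = Complex (- x) e powr a"
      "exp (- (\<i> * of_real pi * a)) * Complex x e powr a = Complex (- x) (- e) powr a"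
      unfolding m powr_def Ln using nz by (simp_all add: exp_add [symmetric] algebra_simps)
  qed
  show "((\<lambda>e. Complex (- x) e powr a) \<longlongrightarrow> exp (\<i> * of_real pi * a) * of_real x powr a) (at_right 0)"
    by (rule Lim_transform_eventually[OF lim(1)])
       (auto intro: eventually_mono[OF eventually_at_right_less] simp: eq)
  show "((\<lambda>e. Complex (- x) (- e) powr a) \<longlongrightarrow> exp (- (\<i> * of_real pi * a)) * of_real x powr a) (at_right 0)"
    by (rule Lim_transform_eventually[OF lim(2)])
       (auto intro: eventually_mono[OF eventually_at_right_less] simp: eq)
qed

lemma has_pv_integral_bessel_wave:
  assumes a: "Re a = - 1 / 2" and b: "b > 0" and x: "x > 0"
    and nz: "rGamma (a + 1) * rGamma (- a) \<noteq> 0"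
  shows "has_pv_integral (\<lambda>t. bessel_wave a b t / of_real (t - x)) {0<..} x
           ((cos (of_real pi * a) * bessel_wave a b x
             - of_real b powr (- a) * bessel_clifford (- a) (- of_real (b * x)))
            / (rGamma (a + 1) * rGamma (- a)))"
proof -
  let ?h = "bessel_wave a b" and ?c = "rGamma (a + 1) * rGamma (- a)"
  let ?S = "\<lambda>z. LINT t|lborel_pos. ?h t / (of_real t + z)"
  let ?B = "\<lambda>z. of_real b powr (- a) * bessel_clifford (- a) (of_real b * z)"
  have le: "norm (?h t) \<le> norm (rGamma (a + 1)) * t powr (- 1 / 2)" if "t > 0" for t
    using norm_bessel_wave_le[OF a _ that] b by simp
  have int: "integrable lborel_pos (\<lambda>t. ?h t / (of_real t + z))" if "z \<notin> \<real>\<^sub>\<le>\<^sub>0" for z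
    using le that by (rule integrable_stieltjes[OF borel_measurable_bessel_wave])
  have slit: "Complex (- x) e \<notin> \<real>\<^sub>\<le>\<^sub>0" if "e \<noteq> 0" for e
    using that by (simp add: complex_nonpos_Reals_iff)
  have S: "?S z = (z powr a * bessel_clifford a (of_real b * z) - ?B z) / ?c" if "z \<notin> \<real>\<^sub>\<le>\<^sub>0" for z
    using stieltjes_bessel_wave[OF a b that] nz by (simp add: field_simps)
  \<comment> \<open>Differentiability of the wave at \<open>x\<close> is that of the holomorphic
    function \<open>z powr a * bessel_clifford a (- b z)\<close>, restricted to real
    increments.\<close>
  obtain D where D: "((\<lambda>t. (?h t - ?h x) / of_real (t - x)) \<longlongrightarrow> D) (at x)"
  proof -
    let ?g = "\<lambda>z. z powr a * bessel_clifford a (- (of_real b * z))"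
    have "of_real x \<notin> (\<real>\<^sub>\<le>\<^sub>0 :: complex set)"
      using x by (simp add: complex_nonpos_Reals_iff)
    then have "?g field_differentiable at (of_real x)"
      unfolding field_differentiable_def by (auto intro!: exI derivative_eq_intros)
    then obtain D where "((\<lambda>z. (?g z - ?g (of_real x)) / (z - of_real x)) \<longlongrightarrow> D) (at (of_real x))"
      unfolding field_differentiable_def has_field_derivative_iff by blast
    moreover have "filterlim of_real (at (of_real x :: complex)) (at x)"
      unfolding filterlim_at by (auto intro!: tendsto_eq_intros simp: eventually_at_filter)
    ultimately have "((\<lambda>t. (?g (of_real t) - ?g (of_real x)) / (of_real t - of_real x)) \<longlongrightarrow> D) (at x)"
      by (rule filterlim_compose)
    then show ?thesis
      by (intro that) (simp add: bessel_wave_def)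
  qed
  show ?thesis
  proof (rule has_pv_integral_Cauchy[OF x borel_measurable_bessel_wave])
    show "integrable lborel_pos (\<lambda>t. ?h t / of_real (1 + t))"
      using int[of 1] by (simp add: add.commute)
    show "integrable lborel_pos (\<lambda>t. ?h t / (of_real t + Complex (- x) e))" if "e \<noteq> 0" for e
      using slit[OF that] by (rule int)
    show "((\<lambda>t. (?h t - ?h x) / of_real (t - x)) \<longlongrightarrow> D) (at x)"
      by (rule D)
    let ?l = "\<lambda>s z. (s * of_real x powr a * bessel_clifford a (of_real b * z) - ?B z) / ?c"
    have lim: "((\<lambda>e. Complex (- x) e) \<longlongrightarrow> - of_real x) (at_right 0)"
      "((\<lambda>e. Complex (- x) (- e)) \<longlongrightarrow> - of_real x) (at_right 0)"
      by (auto intro!: tendsto_eq_intros simp: Complex_eq)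
    have limB: "((\<lambda>e. bessel_clifford s (of_real b * Complex (- x) e)) \<longlongrightarrow> bessel_clifford s (of_real b * - of_real x)) (at_right 0)"
      "((\<lambda>e. bessel_clifford s (of_real b * Complex (- x) (- e))) \<longlongrightarrow> bessel_clifford s (of_real b * - of_real x)) (at_right 0)" for s
      by (intro isCont_tendsto_compose[OF isCont_bessel_clifford] tendsto_intros lim)+
    have "((\<lambda>e. ((Complex (- x) e powr a * bessel_clifford a (of_real b * Complex (- x) e) - ?B (Complex (- x) e)) / ?c
        + (Complex (- x) (- e) powr a * bessel_clifford a (of_real b * Complex (- x) (- e)) - ?B (Complex (- x) (- e))) / ?c) / 2)
        \<longlongrightarrow> (?l (exp (\<i> * of_real pi * a)) (- of_real x) + ?l (exp (- (\<i> * of_real pi * a))) (- of_real x)) / 2)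
        (at_right 0)"
      by (intro tendsto_divide tendsto_add tendsto_diff tendsto_mult tendsto_const limB
            tendsto_powr_cut x nz) simp
    also have "(?l (exp (\<i> * of_real pi * a)) (- of_real x) + ?l (exp (- (\<i> * of_real pi * a))) (- of_real x)) / 2
        = (cos (of_real pi * a) * bessel_wave a b x
             - of_real b powr (- a) * bessel_clifford (- a) (- of_real (b * x))) / ?c"
      using nz by (simp add: bessel_wave_def cos_exp_eq field_simps)
    finally show "((\<lambda>e. (?S (Complex (- x) e) + ?S (Complex (- x) (- e))) / 2)
        \<longlongrightarrow> (cos (of_real pi * a) * bessel_wave a b x
             - of_real b powr (- a) * bessel_clifford (- a) (- of_real (b * x))) / ?c) (at_right 0)"
      by (rule Lim_transform_eventually)
         (auto intro!: eventually_mono[OF eventually_at_right_less] simp: S slit)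
  qed
qed

text \<open>Equality is required on \<open>S\<close> only, since the product formula for
  \<open>bessel_J\<close> at \<open>l * sqrt t\<close> is stated for \<open>t > 0\<close>.\<close>

lemma has_pv_integral_cmult:
  assumes f: "has_pv_integral f S c I"
    and eq: "\<And>t. t \<in> S \<Longrightarrow> g t = k * f t"
  shows "has_pv_integral g S c (k * I)"
proof -
  have ind: "indicator (S - {c - e..c + e}) t *\<^sub>R g t
      = k * (indicator (S - {c - e..c + e}) t *\<^sub>R f t)" for e t
    using eq by (auto simp: indicator_def)
  show ?thesis
    using f unfolding has_pv_integral_def set_integrable_def set_lebesgue_integral_def ind
      integral_mult_right_zero
    by (intro conjI allI impI integrable_mult_right tendsto_mult_left) blast+
qed

section \<open>Return to \<open>bessel_J\<close> and the closing computation\<close>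

lemma bessel_J_mult_sqrt:
  fixes l t :: real
  assumes "l > 0" "t > 0"
  shows "bessel_J s (of_real (l * sqrt t)) = of_real (l / 2) powr s * of_real t powr (s / 2)
           * bessel_clifford s (- of_real ((l / 2)\<^sup>2 * t))"
proof -
  have "of_real (l * sqrt t) / 2 = (of_real (l / 2) * of_real (sqrt t) :: complex)"
    by simp
  moreover have "(of_real (l / 2) * of_real (sqrt t)) powr s
      = (of_real (l / 2) powr s * of_real (sqrt t) powr s :: complex)"
    using assms by (intro powr_times_real) auto
  moreover have "of_real (sqrt t) powr s = (of_real t powr (s / 2) :: complex)"
    using assms by (simp add: powr_def Ln_of_real ln_sqrt)
  moreover have "(of_real (l / 2) * of_real (sqrt t))\<^sup>2 = (of_real ((l / 2)\<^sup>2 * t) :: complex)"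
    unfolding of_real_mult [symmetric] of_real_power [symmetric]
    using assms(2) by (simp only: power_mult_distrib real_sqrt_pow2 less_imp_le)
  ultimately show ?thesis
    unfolding bessel_J_conv_bessel_clifford by (simp only:)
qed

text \<open>\<open>pv_integral\<close> is a definite description, so the equation alone would not
  assert that the principal value exists; \<open>pv_integrable\<close> is therefore part of the
  claim.\<close>

theorem corollary4p6:
  fixes l \<mu> x :: real and \<alpha> :: complex
  assumes "l > 0"
    and "\<alpha> = - 1 / 2 - \<i> * of_real \<mu>"
    and "x > 0"
  shows "pv_integrable
           (\<lambda>t. of_real t powr (\<alpha> / 2) * bessel_J \<alpha> (of_real (l * sqrt t)) / of_real (t - x))
           {0<..} x \<and>
         1 / of_real pi * pv_integral
           (\<lambda>t. of_real t powr (\<alpha> / 2) * bessel_J \<alpha> (of_real (l * sqrt t)) / of_real (t - x))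
           {0<..} x
         + \<i> * of_real (tanh (pi * \<mu>)) * of_real x powr (\<alpha> / 2)
             * bessel_J \<alpha> (of_real (l * sqrt x))
         = - (of_real x powr (\<alpha> / 2) / of_real (cosh (pi * \<mu>)))
             * bessel_J (- \<alpha>) (of_real (l * sqrt x))"
proof -
  let ?f = "\<lambda>t. of_real t powr (\<alpha> / 2) * bessel_J \<alpha> (of_real (l * sqrt t)) / of_real (t - x)"
  define b where "b = (l / 2)\<^sup>2"
  have b: "b > 0" using assms(1) by (simp add: b_def)
  define k where "k = (of_real (l / 2) powr \<alpha> :: complex)"
  define C where "C = complex_of_real (cosh (pi * \<mu>))"
  have C: "C \<noteq> 0" by (simp add: C_def)
  define v where "v = bessel_clifford (- \<alpha>) (- of_real (b * x))"
  have Re: "Re \<alpha> = - 1 / 2" by (simp add: assms(2))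
  have wave: "of_real t powr (\<alpha> / 2) * bessel_J \<alpha> (of_real (l * sqrt t)) = k * bessel_wave \<alpha> b t"
    if "t > 0" for t
  proof -
    have eq: "of_real t powr \<alpha> = (of_real t powr (\<alpha> / 2) * of_real t powr (\<alpha> / 2) :: complex)"
      by (simp flip: powr_add)
    show ?thesis
      unfolding bessel_J_mult_sqrt[OF assms(1) that] bessel_wave_def k_def b_def eq
      by (simp only: mult_ac)
  qed
  \<comment> \<open>The shift by \<open>pi / 2\<close> swaps sine and cosine:
    \<open>cos (pi \<alpha>)\<close> becomes a hyperbolic sine and
    \<open>sin (- pi \<alpha>)\<close> the hyperbolic cosine, which never vanishes.\<close>
  have \<pi>\<alpha>: "of_real pi * \<alpha> = - (of_real pi / 2) - \<i> * of_real (pi * \<mu>)"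
    by (simp add: assms(2) algebra_simps)
  have sin_cos: "sin (\<i> * of_real (pi * \<mu>)) = \<i> * of_real (sinh (pi * \<mu>))"
    "cos (\<i> * of_real (pi * \<mu>)) = C"
  proof -
    have "sinh (of_real y) = (of_real (sinh y) :: complex)" "cosh (of_real y) = (of_real (cosh y) :: complex)"
      for y by (simp_all add: sinh_def cosh_def scaleR_conv_of_real exp_of_real flip: of_real_minus)
    then show "sin (\<i> * of_real (pi * \<mu>)) = \<i> * of_real (sinh (pi * \<mu>))"
      "cos (\<i> * of_real (pi * \<mu>)) = C"
      unfolding C_def using sinh_conv_sin[of "of_real (pi * \<mu>)"] cosh_conv_cos[of "of_real (pi * \<mu>)"]
      by (simp_all only:) (simp flip: mult.assoc)
  qed
  have half: "sin (complex_of_real pi / 2) = 1" "cos (complex_of_real pi / 2) = 0"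
    by (metis of_real_1 of_real_divide of_real_numeral sin_of_real sin_pi_half)
       (metis of_real_0 of_real_divide of_real_numeral cos_of_real cos_pi_half)
  have cos: "cos (of_real pi * \<alpha>) = - \<i> * of_real (sinh (pi * \<mu>))"
    unfolding \<pi>\<alpha> cos_diff cos_minus sin_minus half sin_cos by simp
  have "rGamma (\<alpha> + 1) * rGamma (- \<alpha>) = sin (of_real pi * - \<alpha>) / of_real pi"
    using rGamma_reflection_complex[of "- \<alpha>"] by (simp add: mult.commute add.commute)
  also have "sin (of_real pi * - \<alpha>) = C"
    unfolding mult_minus_right sin_minus \<pi>\<alpha> sin_diff cos_minus half sin_cos by simp
  finally have rG: "rGamma (\<alpha> + 1) * rGamma (- \<alpha>) = C / of_real pi" .
  have "has_pv_integral (\<lambda>t. bessel_wave \<alpha> b t / of_real (t - x)) {0<..} x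
      ((cos (of_real pi * \<alpha>) * bessel_wave \<alpha> b x - of_real b powr (- \<alpha>) * v)
        / (rGamma (\<alpha> + 1) * rGamma (- \<alpha>)))"
    unfolding v_def using C by (intro has_pv_integral_bessel_wave Re b assms) (simp add: rG)
  then have pv: "has_pv_integral ?f {0<..} x
      (k * ((cos (of_real pi * \<alpha>) * bessel_wave \<alpha> b x - of_real b powr (- \<alpha>) * v)
        / (rGamma (\<alpha> + 1) * rGamma (- \<alpha>))))"
    by (rule has_pv_integral_cmult) (simp add: wave del: of_real_mult of_real_diff)
  have J: "of_real x powr (\<alpha> / 2) * bessel_J (- \<alpha>) (of_real (l * sqrt x)) = k * of_real b powr (- \<alpha>) * v"
  proof -
    have "of_real b powr (- \<alpha>) = (of_real (l / 2) powr (- \<alpha>) * of_real (l / 2) powr (- \<alpha>) :: complex)"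
      using assms(1) powr_times_real[of "of_real (l / 2)" "of_real (l / 2)" "- \<alpha>"]
      by (simp add: b_def power2_eq_square)
    \<comment> \<open>\<open>b\<close> is the square of \<open>l / 2\<close>, so
      \<open>b powr (- \<alpha>)\<close> turns the prefactor of the Bessel function of order
      \<open>\<alpha>\<close> into that of order \<open>- \<alpha>\<close>.\<close>
    then have k: "k * of_real b powr (- \<alpha>) = of_real (l / 2) powr (- \<alpha>)"
      using assms(1) by (simp add: k_def powr_minus)
    have "of_real x powr (\<alpha> / 2) * of_real x powr (- \<alpha> / 2) = (1 :: complex)"
      using assms(3) by (simp flip: powr_add)
    then have "of_real x powr (\<alpha> / 2) * (y * of_real x powr (- \<alpha> / 2) * z) = y * z" for y z
      by (simp only: mult.left_commute mult.assoc) simp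
    then show ?thesis
      unfolding bessel_J_mult_sqrt[OF assms(1,3)] v_def b_def [symmetric] k by blast
  qed
  \<comment> \<open>The \<open>pi\<close> of the reflection formula cancels \<open>1 / pi\<close>.
    After division by \<open>C\<close> the first summand is \<open>- i tanh (pi \<mu>)\<close> times
    the numerator at \<open>x\<close>, which the added term of the theorem removes.\<close>
  have P: "1 / of_real pi * pv_integral ?f {0<..} x
      = (- \<i> * of_real (sinh (pi * \<mu>)) * (k * bessel_wave \<alpha> b x) - k * of_real b powr (- \<alpha>) * v) / C"
    unfolding pv_integral_eqI[OF pv] rG cos using C by (simp add: field_simps)
  have "1 / of_real pi * pv_integral ?f {0<..} x
      + \<i> * of_real (tanh (pi * \<mu>)) * (of_real x powr (\<alpha> / 2) * bessel_J \<alpha> (of_real (l * sqrt x)))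
      = - (of_real x powr (\<alpha> / 2) * bessel_J (- \<alpha>) (of_real (l * sqrt x))) / C"
    unfolding P wave[OF assms(3)] J tanh_def of_real_divide C_def [symmetric]
    by (simp add: diff_divide_distrib)
  then show ?thesis
    using pv unfolding pv_integrable_def C_def by (auto simp: mult.assoc)
qed

end
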